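(* Let $\Omega\subset\mathbb{R}^d$ be a bounded Lipschitz domain, $T>0$, and let $a:\mathbb{R}\to\mathbb{R}^+$ be Lipschitz continuous with $m\le a(s)\le M$ for all $s\in\mathbb{R}$, where $0<m\le M<\infty$. Let $V_h$ be the space-time isogeometric space described in the context and let $f\in Z=L^2(0,T;L^2(\Omega))$. Then there exists $u_h\in V_h$ such that $$\int_0^T\int_\Omega \partial_t u_h\,v_h\,d\Omega\,dt+\int_0^T\int_\Omega a(l(u_h))\nabla u_h\cdot\nabla v_h\,d\Omega\,dt=\int_0^T\int_\Omega f v_h\,d\Omega\,dt\quad\forall v_h\in V_h,$$ where $l(v)=\int_\Omega v\,d\Omega$ (computed at each time $t$).
   Context: Isogeometric space: for integers $q\ge1$ and an open knot vector $\{0=\zeta_1\le\dots\le\zeta_{n+q+1}=1\}$ (first and last $q+1$ knots repeated) the univariate B-splines of degree $q$ are given by the Cox–de Boor recursion; we use maximal regularity, and spline spaces are assumed to be contained in $C^0$. Take $d$ spatial knot vectors with degree $q_s\ge1$ and one time knot vector with degree $q_t\ge1$, all quasi-uniform (there is $0<\alpha<1$ with every nonempty knot span of a spatial knot vector of length in $[\alpha h_s,h_s]$ and every nonempty knot span of the time knot vector of length in $[\alpha h_t,h_t]$); the tensor-product B-splines $\widehat B(\zeta,\tau)=\widehat b_{j_1}(\zeta_1)\cdots\widehat b_{j_d}(\zeta_d)\widehat b_{j_t}(\tau)$ span $\widehat{\mathcal S}_{h,\mathbf q}$ on $\widehat\Omega\times(0,1)$, $\widehat\Omega=(0,1)^d$.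 The spatial domain is parametrized by $\widehat{\mathbf F}:\widehat\Omega\to\Omega$ whose components lie in the spatial spline space and whose inverse has bounded piecewise derivatives of all orders; set $\widehat{\mathbf G}(\zeta,\tau)=(\widehat{\mathbf F}(\zeta),T\tau)$. Then $V_h=\{\widehat u\circ\widehat{\mathbf G}^{-1}:\widehat u\in\widehat{\mathcal S}_{h,\mathbf q},\ \widehat u=0 \text{ on }\partial\widehat\Omega\times(0,1),\ \widehat u=0\text{ on }\widehat\Omega\times\{0\}\}$. *)

theory Defs
  imports "HOL-Analysis.Analysis"
begin

text \<open>Knots are a list Z = [Z!0, ..., Z!(n+q)]; the i-th B-spline of degree p
  (i = 0..n-1 for p = q) is supported on [Z!i, Z!(i+p+1)].  Quotients with zero
  denominator are 0 (Isabelle's convention x/0 = 0, the usual 0/0 := 0 convention).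
  Degree-0 functions are indicator functions of half-open spans, except that the
  span ending at the last knot is closed on the right (standard convention).\<close>

fun bspline :: "real list \<Rightarrow> nat \<Rightarrow> nat \<Rightarrow> real \<Rightarrow> real" where
  "bspline Z 0 i x =
     (if (Z!i \<le> x \<and> x < Z!(i+1)) \<or> (Z!i < Z!(i+1) \<and> x = Z!(i+1) \<and> Z!(i+1) = last Z)
      then 1 else 0)"
| "bspline Z (Suc p) i x =
     (x - Z!i) / (Z!(i+p+1) - Z!i) * bspline Z p i x
     + (Z!(i+p+2) - x) / (Z!(i+p+2) - Z!(i+1)) * bspline Z p (i+1) x"

definition nbasis :: "real list \<Rightarrow> nat \<Rightarrow> nat" where
  "nbasis Z q = length Z - q - 1"

definition open_knots_maxreg :: "nat \<Rightarrow> real list \<Rightarrow> bool" where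
  "open_knots_maxreg q Z \<longleftrightarrow>
     (let n = nbasis Z q in
       length Z = n + q + 1 \<and> sorted Z \<and>
       (\<forall>i\<le>q. Z!i = 0 \<and> Z!(n+i) = 1) \<and>
       (\<forall>i. q \<le> i \<and> i < n \<longrightarrow> Z!i < Z!(i+1)))"

definition quasi_uniform :: "real \<Rightarrow> real \<Rightarrow> real list \<Rightarrow> bool" where
  "quasi_uniform \<alpha> h Z \<longleftrightarrow>
     (\<forall>i. i + 1 < length Z \<longrightarrow> Z!i < Z!(i+1) \<longrightarrow>
        \<alpha> * h \<le> Z!(i+1) - Z!i \<and> Z!(i+1) - Z!i \<le> h)"

definition sp_index :: "('d::finite \<Rightarrow> real list) \<Rightarrow> nat \<Rightarrow> ('d \<Rightarrow> nat) set" where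
  "sp_index Zs qs = {j. \<forall>k. j k < nbasis (Zs k) qs}"

definition sp_basis :: "('d::finite \<Rightarrow> real list) \<Rightarrow> nat \<Rightarrow> ('d \<Rightarrow> nat) \<Rightarrow> real^'d \<Rightarrow> real" where
  "sp_basis Zs qs j \<zeta> = (\<Prod>k\<in>UNIV. bspline (Zs k) qs (j k) (\<zeta> $ k))"

definition spatial_splines :: "('d::finite \<Rightarrow> real list) \<Rightarrow> nat \<Rightarrow> (real^'d \<Rightarrow> real) set" where
  "spatial_splines Zs qs =
     {(\<lambda>\<zeta>. \<Sum>j\<in>sp_index Zs qs. c j * sp_basis Zs qs j \<zeta>) | c. True}"

definition st_splines ::
  "('d::finite \<Rightarrow> real list) \<Rightarrow> nat \<Rightarrow> real list \<Rightarrow> nat \<Rightarrow> (real^'d \<Rightarrow> real \<Rightarrow> real) set" where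
  "st_splines Zs qs Zt qt =
     {(\<lambda>\<zeta> \<tau>. \<Sum>(j,jt)\<in>sp_index Zs qs \<times> {..<nbasis Zt qt}.
          c (j,jt) * sp_basis Zs qs j \<zeta> * bspline Zt qt jt \<tau>) | c. True}"

definition unit_cube :: "(real^'d::finite) set" where
  "unit_cube = {\<zeta>. \<forall>k. 0 < \<zeta> $ k \<and> \<zeta> $ k < 1}"

definition unit_cube_boundary :: "(real^'d::finite) set" where
  "unit_cube_boundary =
     {\<zeta>. (\<forall>k. 0 \<le> \<zeta> $ k \<and> \<zeta> $ k \<le> 1) \<and> (\<exists>k. \<zeta> $ k = 0 \<or> \<zeta> $ k = 1)}"

definition mesh_element :: "('d::finite \<Rightarrow> real list) \<Rightarrow> ('d \<Rightarrow> nat) \<Rightarrow> (real^'d) set" where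
  "mesh_element Zs e = {\<zeta>. \<forall>k. Zs k ! (e k) < \<zeta> $ k \<and> \<zeta> $ k < Zs k ! (e k + 1)}"

fun iter_pderiv :: "'d list \<Rightarrow> (real^'d::finite \<Rightarrow> real) \<Rightarrow> real^'d \<Rightarrow> real" where
  "iter_pderiv [] g = g"
| "iter_pderiv (i # is) g = (\<lambda>x. deriv (\<lambda>s. iter_pderiv is g (x + s *\<^sub>R axis i 1)) 0)"

definition bounded_derivs_all_orders :: "(real^'d::finite) set \<Rightarrow> (real^'d \<Rightarrow> real) \<Rightarrow> bool" where
  "bounded_derivs_all_orders S g \<longleftrightarrow>
     (\<forall>ds. bounded (iter_pderiv ds g ` S) \<and>
        (\<forall>i. \<forall>x\<in>S. \<exists>D. ((\<lambda>s. iter_pderiv ds g (x + s *\<^sub>R axis i 1)) has_real_derivative D) (at 0)))"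

text \<open>Open connected set whose boundary is locally the graph of a Lipschitz function:
  near each boundary point, in a direction e, the set is the subgraph
  {y. y \<bullet> e < \<gamma> y} with \<gamma> Lipschitz and independent of the e-coordinate.\<close>
definition lipschitz_domain :: "(real^'d::finite) set \<Rightarrow> bool" where
  "lipschitz_domain \<Omega> \<longleftrightarrow> open \<Omega> \<and> connected \<Omega> \<and> \<Omega> \<noteq> {} \<and>
     (\<forall>x\<in>frontier \<Omega>. \<exists>r>0. \<exists>e L \<gamma>. norm e = 1 \<and> lipschitz_on L UNIV \<gamma> \<and>
        (\<forall>y t. \<gamma> (y + t *\<^sub>R e) = \<gamma> y) \<and>
        \<Omega> \<inter> ball x r = {y \<in> ball x r. y \<bullet> e < \<gamma> y})"

definition Vh ::
  "('d::finite \<Rightarrow> real list) \<Rightarrow> nat \<Rightarrow> real list \<Rightarrow> nat \<Rightarrow> (real^'d \<Rightarrow> real^'d) \<Rightarrow> real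
     \<Rightarrow> ((real^'d) \<times> real \<Rightarrow> real) set" where
  "Vh Zs qs Zt qt F T =
     {(\<lambda>(x,t). u (the_inv_into unit_cube F x) (t / T)) | u.
        u \<in> st_splines Zs qs Zt qt \<and>
        (\<forall>\<zeta>\<in>unit_cube_boundary. \<forall>\<tau>. 0 < \<tau> \<and> \<tau> < 1 \<longrightarrow> u \<zeta> \<tau> = 0) \<and>
        (\<forall>\<zeta>\<in>unit_cube. u \<zeta> 0 = 0)}"

section \<open>Derivatives of space-time functions (classical, defined a.e. for V_h)\<close>

definition time_deriv :: "((real^'d::finite) \<times> real \<Rightarrow> real) \<Rightarrow> (real^'d) \<times> real \<Rightarrow> real" where
  "time_deriv u z = deriv (\<lambda>s. u (fst z, s)) (snd z)"

definition space_grad :: "((real^'d::finite) \<times> real \<Rightarrow> real) \<Rightarrow> (real^'d) \<times> real \<Rightarrow> real^'d" where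
  "space_grad u z = (\<chi> i. deriv (\<lambda>s. u (fst z + s *\<^sub>R axis i 1, snd z)) 0)"

definition lmean :: "(real^'d::finite) set \<Rightarrow> ((real^'d) \<times> real \<Rightarrow> real) \<Rightarrow> real \<Rightarrow> real" where
  "lmean \<Omega> v t = set_lebesgue_integral lborel \<Omega> (\<lambda>x. v (x, t))"

end

theory Submission
  imports Defs
    "HOL-Homology.Brouwer_Degree"
    "HOL-Library.Function_Algebras"
    "HOL-Computational_Algebra.Polynomial"
begin

text \<open>The discrete problem is a finite system of nonlinear equations for the coefficients of
  \<open>u\<^sub>h\<close>.  Testing with \<open>v\<^sub>h = u\<^sub>h\<close>, the time term is
  \<open>\<integral> u\<^sub>h(T)\<^sup>2 / 2 \<ge> 0\<close> because \<open>u\<^sub>h\<close> vanishes at \<open>t = 0\<close>, and the diffusion term is at least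
  \<open>m \<integral> \<bar>\<nabla>u\<^sub>h\<bar>\<^sup>2\<close>, which is positive definite by the lateral boundary condition.  Hence the system
  is an outward pointing vector field on a large sphere, and it has a zero since spheres are not
  contractible.  The physical gradient is controlled on the open set of full measure over which the
  parametrization is smooth; there the chain rule for \<open>F \<circ> F\<inverse> = id\<close> shows that the Jacobian of
  \<open>F\<inverse>\<close> is invertible, so that the physical gradient vanishes exactly where the reference gradient
  does.\<close>

section \<open>Zeros of outward pointing vector fields\<close>

text \<open>Two features shape the proof. The size of the system is the cardinality of a basis that
  is only obtained inside the proof, so coefficient vectors are not elements of a vector type but
  sequences in \<open>coord_space n\<close>, vanishing from index n on; this is also the form in
  which \<open>nsphere\<close> describes its spheres. Secondly, a member of V_h is a function on all
  of space-time built with \<open>the_inv_into\<close>, hence unspecified outside \<Omega>, and its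
  derivatives are classical ones that need not exist over the knot hyperplanes. Linear algebra is
  therefore done on coefficient families, and identities between derivatives are stated only on the
  set \<open>S\<close> of regular space-time points. That \<open>S\<close> is open matters as much
  as its full measure: a continuous function that vanishes almost everywhere on \<open>S\<close>
  vanishes on all of it, and functions that agree on \<open>S\<close> have the same gradients there.
  The nonlinearity enters the vector field only through the bounded factor a(l(u)), so dominated
  convergence makes the field continuous, while the bound a \<ge> m fixes the radius of the sphere
  in terms of the load.\<close>

definition coord_space :: "nat \<Rightarrow> (nat \<Rightarrow> real) set" where
  "coord_space n = {x. \<forall>i\<ge>n. x i = 0}"

text \<open>The k-sphere needs the k+1 coordinates 0, ..., k, hence \<open>Suc k\<close>. The set is
  the carrier of \<open>nsphere k\<close>, whose non-contractibility is a homology fact.\<close>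

lemma not_contractible_unit_sphere:
  "\<not> contractible {x \<in> coord_space (Suc k). (\<Sum>i<Suc k. (x i)\<^sup>2) = 1}"
proof -
  have eq: "{x \<in> coord_space (Suc k). (\<Sum>i<Suc k. (x i)\<^sup>2) = 1} =
      {x. (\<Sum>i\<le>k. (x i)\<^sup>2) = 1 \<and> (\<forall>i>k. x i = 0)}"
    by (auto simp: coord_space_def lessThan_Suc_atMost Suc_le_eq)
  have "nsphere k = top_of_set {x \<in> coord_space (Suc k). (\<Sum>i<Suc k. (x i)\<^sup>2) = 1}"
    unfolding nsphere eq by (simp add: euclidean_product_topology)
  then show ?thesis
    using non_contractible_space_nsphere[of k] by simp
qed

text \<open>If \<open>G\<close> had no zero, \<open>G\<close> divided by its length would be
  continuous everywhere. Read on the sphere of radius R it would be homotopic to the identity, since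
  it never points against x, and, by shrinking the radius to 0, also to a constant map. The unit
  sphere would then be contractible.\<close>

lemma outward_field_has_zero:
  fixes G :: "(nat \<Rightarrow> real) \<Rightarrow> nat \<Rightarrow> real"
  assumes cont: "\<And>i. i < n \<Longrightarrow> continuous_on (coord_space n) (\<lambda>x. G x i)"
    and out: "\<And>x. x \<in> coord_space n \<Longrightarrow> (\<Sum>i<n. (x i)\<^sup>2) = R\<^sup>2 \<Longrightarrow> 0 < (\<Sum>i<n. G x i * x i)"
  shows "\<exists>x\<in>coord_space n. \<forall>i<n. G x i = 0"
proof (cases n)
  case 0
  then show ?thesis by (auto simp: coord_space_def intro: exI[of _ "\<lambda>_. 0"])
next
  case (Suc k)
  show ?thesis
  proof (rule ccontr)
    assume nz: "\<not> ?thesis"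
    define S where "S = {x \<in> coord_space n. (\<Sum>i<n. (x i)\<^sup>2) = 1}"
    define sq where "sq y = (\<Sum>j<n. (y j)\<^sup>2)" for y :: "nat \<Rightarrow> real"
    define N where "N y = (\<lambda>i. if i < n then y i / sqrt (sq y) else 0)" for y :: "nat \<Rightarrow> real"
    have sq_pos: "0 < sq y" if "j < n" "y j \<noteq> 0" for y j
      unfolding sq_def using that by (intro sum_pos2[where i=j]) auto
    have N_S: "N y \<in> S" if "0 < sq y" for y
    proof -
      have "(\<Sum>i<n. (N y i)\<^sup>2) = (\<Sum>i<n. (y i)\<^sup>2 / sq y)"
        using that by (intro sum.cong) (auto simp: N_def power_divide)
      also have "\<dots> = 1"
        using that by (simp add: sum_divide_distrib[symmetric] sq_def)
      finally show ?thesis by (auto simp: S_def coord_space_def N_def)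
    qed
    have N_cont: "continuous_on A (\<lambda>z. N (H z))"
      if "\<And>i. i < n \<Longrightarrow> continuous_on A (\<lambda>z. H z i)" "\<And>z. z \<in> A \<Longrightarrow> 0 < sq (H z)"
      for A :: "(real \<times> (nat \<Rightarrow> real)) set" and H
    proof (rule continuous_on_coordinatewise_then_product)
      fix i
      have sqc: "continuous_on A (\<lambda>z. sq (H z))"
        unfolding sq_def by (intro continuous_intros that(1)) auto
      have "\<forall>z\<in>A. sqrt (sq (H z)) \<noteq> 0"
        using that(2) by force
      then show "continuous_on A (\<lambda>z. N (H z) i)"
        unfolding N_def using that(1)[of i] sqc
        by (cases "i < n") (auto intro!: continuous_intros)
    qed
    have scale: "(\<lambda>i. r * x i) \<in> coord_space n" if "x \<in> S" for r x
      using that by (auto simp: S_def coord_space_def)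
    have scale_cont: "continuous_on A (\<lambda>z. (\<lambda>i. r z * snd z i))" if "continuous_on A r"
      for A :: "(real \<times> (nat \<Rightarrow> real)) set" and r :: "real \<times> (nat \<Rightarrow> real) \<Rightarrow> real"
    proof (rule continuous_on_coordinatewise_then_product)
      fix i
      have "continuous_on A (\<lambda>z. snd z i)"
        by (rule continuous_on_product_then_coordinatewise) (intro continuous_intros)
      then show "continuous_on A (\<lambda>z. r z * snd z i)"
        using that by (intro continuous_intros)
    qed
    have coord: "continuous_on A (\<lambda>z. snd z i)" for A :: "(real \<times> (nat \<Rightarrow> real)) set" and i
      by (rule continuous_on_product_then_coordinatewise) (intro continuous_intros)
    have G_cont: "continuous_on ({0..1} \<times> S) (\<lambda>z. G (\<lambda>i. r z * snd z i) i)"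
      if "continuous_on ({0..1} \<times> S) r" "i < n" for r :: "real \<times> (nat \<Rightarrow> real) \<Rightarrow> real" and i
      by (rule continuous_on_compose2[OF cont[OF that(2)] scale_cont[OF that(1)]])
        (use scale in auto)
    \<comment> \<open>For R = 0 the hypothesis \<open>out\<close> at the origin would read 0 <
      0.\<close>
    have R0: "R \<noteq> 0"
    proof
      assume "R = 0"
      then show False using out[of "\<lambda>_. 0"] by (auto simp: coord_space_def)
    qed
    define x0 :: "nat \<Rightarrow> real" where "x0 = (\<lambda>i. 0)"
    have sqG: "0 < sq (G x)" if "x \<in> coord_space n" for x
      using nz that sq_pos by blast
    have Rpos: "0 < (\<Sum>i<n. (\<bar>R\<bar> * x i) * G (\<lambda>i. \<bar>R\<bar> * x i) i)" if "x \<in> S" for x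
      using out[OF scale[OF that, of "\<bar>R\<bar>"]] that
      by (simp add: power_mult_distrib sum_distrib_left[symmetric] S_def mult.commute)
    have h1: "homotopic_with_canon (\<lambda>_. True) S S (\<lambda>x. x) (\<lambda>x. N (G (\<lambda>i. \<bar>R\<bar> * x i)))"
    proof -
      \<comment> \<open>The normalised segment from x to the field at |R| x. If the segment met 0,
        pairing that point with |R| x would give 0, although both contributions are nonnegative and
        one of them is positive.\<close>
      define h where "h z = N (\<lambda>i. (1 - fst z) * snd z i + fst z * G (\<lambda>i. \<bar>R\<bar> * snd z i) i)"
        for z :: "real \<times> (nat \<Rightarrow> real)"
      have pos: "0 < sq (\<lambda>i. (1 - t) * x i + t * G (\<lambda>i. \<bar>R\<bar> * x i) i)"
        if t: "t \<in> {0..1}" and x: "x \<in> S" for t x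
      proof (rule ccontr)
        let ?y = "\<lambda>i. (1 - t) * x i + t * G (\<lambda>i. \<bar>R\<bar> * x i) i"
        assume neg: "\<not> 0 < sq ?y"
        have z: "?y i = 0" if "i < n" for i
          using sq_pos[of i ?y] that neg by (rule_tac ccontr) simp
        have "0 = (\<Sum>i<n. \<bar>R\<bar> * x i * ((1 - t) * x i + t * G (\<lambda>i. \<bar>R\<bar> * x i) i))"
          by (rule sum.neutral[symmetric]) (use z in auto)
        also have "\<dots> = \<bar>R\<bar> * (1 - t) * (\<Sum>i<n. (x i)\<^sup>2)
            + t * (\<Sum>i<n. (\<bar>R\<bar> * x i) * G (\<lambda>i. \<bar>R\<bar> * x i) i)"
          unfolding sum_distrib_left sum.distrib[symmetric]
          by (intro sum.cong) (auto simp: algebra_simps power2_eq_square)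
        also have "\<dots> = \<bar>R\<bar> * (1 - t) + t * (\<Sum>i<n. (\<bar>R\<bar> * x i) * G (\<lambda>i. \<bar>R\<bar> * x i) i)"
          using x by (simp add: S_def)
        also have "\<dots> > 0"
        proof (cases "t = 0")
          case True then show ?thesis using R0 by simp
        next
          case False then show ?thesis using Rpos[OF x] t by (intro add_nonneg_pos) auto
        qed
        finally show False by simp
      qed
      have "continuous_on ({0..1} \<times> S) h"
        unfolding h_def
      proof (rule N_cont)
        fix z :: "real \<times> (nat \<Rightarrow> real)" assume "z \<in> {0..1} \<times> S"
        then show "0 < sq (\<lambda>i. (1 - fst z) * snd z i + fst z * G (\<lambda>i. \<bar>R\<bar> * snd z i) i)"
          using pos[of "fst z" "snd z"] by auto
      qed (intro continuous_intros coord G_cont)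
      moreover have "h ` ({0..1} \<times> S) \<subseteq> S"
        unfolding h_def using N_S pos by auto
      moreover have "h (0, x) = x" if "x \<in> S" for x
        using that by (auto simp: h_def N_def S_def coord_space_def sq_def fun_eq_iff)
      moreover have "h (1, x) = N (G (\<lambda>i. \<bar>R\<bar> * x i))" for x
        by (simp add: h_def)
      ultimately show ?thesis
        by (subst homotopic_with) (auto intro!: exI[of _ h])
    qed
    have h2: "homotopic_with_canon (\<lambda>_. True) S S (\<lambda>x. N (G x0)) (\<lambda>x. N (G (\<lambda>i. \<bar>R\<bar> * x i)))"
    proof -
      \<comment> \<open>The radius runs from 0 to |R|. The field is nonzero on the whole space by
        assumption, so normalising is possible for every radius.\<close>
      define h where "h z = N (G (\<lambda>i. (fst z * \<bar>R\<bar>) * snd z i))" for z :: "real \<times> (nat \<Rightarrow> real)"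
      have "continuous_on ({0..1} \<times> S) h"
        unfolding h_def
        by (rule N_cont) (use sqG scale in \<open>auto intro!: G_cont continuous_intros\<close>)
      moreover have "h ` ({0..1} \<times> S) \<subseteq> S"
        unfolding h_def using N_S sqG scale by auto
      moreover have "h (0, x) = N (G x0)" for x by (simp add: h_def x0_def)
      moreover have "h (1, x) = N (G (\<lambda>i. \<bar>R\<bar> * x i))" for x by (simp add: h_def)
      ultimately show ?thesis
        by (subst homotopic_with) (auto intro!: exI[of _ h])
    qed
    have "homotopic_with_canon (\<lambda>_. True) S S (\<lambda>x. x) (\<lambda>x. N (G x0))"
      using h1 h2 homotopic_with_symD homotopic_with_trans by blast
    then have "contractible S"
      unfolding contractible_def id_def by blast
    then show False
      using not_contractible_unit_sphere[of k] unfolding S_def Suc by simp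
  qed
qed

section \<open>Bases of finitely generated function spaces\<close>

lemma sum_fun_apply: "(\<Sum>i\<in>I. f i) z = (\<Sum>i\<in>I. f i z)"
  for f :: "'i \<Rightarrow> 'z \<Rightarrow> 'b::comm_monoid_add"
  by (induction I rule: infinite_finite_induct) auto

text \<open>\<open>V\<close> merely lies in a finitely generated space: it is not assumed closed
  under sums, and the generators may be dependent. A maximal independent subset of \<open>V\<close>
  still spans it, and its size is bounded by the number of generators.\<close>

lemma function_space_basis:
  fixes V :: "('z \<Rightarrow> real) set" and \<psi> :: "'j \<Rightarrow> 'z \<Rightarrow> real"
  assumes "finite J" and V: "\<And>v. v \<in> V \<Longrightarrow> \<exists>c. \<forall>z. v z = (\<Sum>j\<in>J. c j * \<psi> j z)"
  shows "\<exists>(n::nat) b. (\<forall>i<n. b i \<in> V) \<and> (\<forall>v\<in>V. \<exists>r. \<forall>z. v z = (\<Sum>i<n. r i * b i z)) \<and>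
     (\<forall>r. (\<forall>z. (\<Sum>i<n. r i * b i z) = 0) \<longrightarrow> (\<forall>i<n. r i = 0))"
proof -
  \<comment> \<open>Addition is the pointwise one of the function type; only the scaling has to be
    supplied.\<close>
  have vs: "vector_space (\<lambda>(r::real) (f::'z \<Rightarrow> real). (\<lambda>z. r * f z))"
    by unfold_locales (simp_all add: fun_eq_iff distrib_left distrib_right mult.assoc)
  interpret fs: vector_space "\<lambda>(r::real) (f::'z \<Rightarrow> real). (\<lambda>z. r * f z)"
    by (rule vs)
  obtain B where B: "B \<subseteq> V" "fs.independent B" "V \<subseteq> fs.span B"
    using fs.basis_exists[of V] .
  have "v \<in> fs.span (\<psi> ` J)" if v: "v \<in> V" for v
  proof -
    obtain c where "\<forall>z. v z = (\<Sum>j\<in>J. c j * \<psi> j z)" using V[OF v] by blast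
    then have "v = (\<Sum>j\<in>J. (\<lambda>z. c j * \<psi> j z))" by (simp add: fun_eq_iff sum_fun_apply)
    moreover have "(\<Sum>j\<in>J. (\<lambda>z. c j * \<psi> j z)) \<in> fs.span (\<psi> ` J)"
      by (rule fs.span_sum, rule fs.span_scale, rule fs.span_base, rule imageI)
    ultimately show ?thesis by simp
  qed
  then have fin: "finite B"
    using fs.independent_span_bound[of "\<psi> ` J" B] B \<open>finite J\<close> by blast
  define n where "n = card B"
  obtain b where b: "bij_betw b {..<n} B"
    using ex_bij_betw_nat_finite[OF fin] by (auto simp: n_def lessThan_atLeast0)
  have sum_eq: "(\<Sum>v\<in>B. (\<lambda>z. u v * v z)) z = (\<Sum>i<n. u (b i) * b i z)" for u z
    unfolding sum_fun_apply using sum.reindex_bij_betw[OF b, of "\<lambda>v. u v * v z"] by simp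
  have "\<exists>r. \<forall>z. v z = (\<Sum>i<n. r i * b i z)" if "v \<in> V" for v
  proof -
    have "v \<in> range (\<lambda>u. \<Sum>v\<in>B. (\<lambda>z. u v * v z))"
      using that B(3) fs.span_finite[OF fin] by auto
    then obtain u where "v = (\<Sum>v\<in>B. (\<lambda>z. u v * v z))" by (elim rangeE)
    then have "\<forall>z. v z = (\<Sum>i<n. u (b i) * b i z)" by (simp only: sum_eq) simp
    then show ?thesis by (rule exI[of _ "\<lambda>i. u (b i)"])
  qed
  moreover have "r i = 0" if r: "\<forall>z. (\<Sum>i<n. r i * b i z) = 0" and i: "i < n" for r i
  proof -
    define u where "u v = r (inv_into {..<n} b v)" for v
    have ub: "u (b i) = r i" if "i < n" for i
      using b that by (simp add: u_def bij_betw_def)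
    have "(\<Sum>v\<in>B. (\<lambda>z. u v * v z)) = 0"
      using r unfolding fun_eq_iff sum_eq by (simp add: ub)
    moreover have "b i \<in> B" using b i by (auto simp: bij_betw_def)
    ultimately have "u (b i) = 0" using fs.independentD[OF B(2) fin subset_refl] by blast
    then show ?thesis using ub[OF i] by simp
  qed
  moreover have "\<forall>i<n. b i \<in> V" using b B(1) by (auto simp: bij_betw_def)
  ultimately show ?thesis by blast
qed

section \<open>Coercive nonlinear Galerkin systems\<close>

text \<open>The ambient space of sequences is infinite-dimensional, so closed and bounded would not
  suffice. Compactness comes from Tychonoff: the sphere is a closed subset of the cube of all
  sequences with values in [-1,1].\<close>

lemma compact_unit_sphere_coord_space:
  "compact {x \<in> coord_space n. (\<Sum>i<n. (x i)\<^sup>2) = 1}"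
proof -
  let ?S = "{x \<in> coord_space n. (\<Sum>i<n. (x i)\<^sup>2) = 1}"
  let ?K = "\<Pi>\<^sub>E i\<in>UNIV. {-1..1::real}"
  have K: "compact ?K"
    using compactin_PiE[of "\<lambda>_. euclideanreal" UNIV "\<lambda>_. {-1..1}"]
    by (simp add: euclidean_product_topology)
  have "?S \<subseteq> ?K"
  proof
    fix x assume x: "x \<in> ?S"
    have "x i \<in> {-1..1}" for i
    proof (cases "i < n")
      case True
      then have "(x i)\<^sup>2 \<le> (\<Sum>i<n. (x i)\<^sup>2)"
        by (intro member_le_sum) auto
      then have "\<bar>x i\<bar> \<le> 1" using x by (simp add: abs_square_le_1)
      then show ?thesis by auto
    next
      case False
      then show ?thesis using x by (auto simp: coord_space_def)
    qed
    then show "x \<in> ?K" by auto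
  qed
  moreover have "closed ?S"
  proof -
    have "?S = (\<Inter>i\<in>{n..}. {x. x i = 0}) \<inter> {x. (\<Sum>i<n. (x i)\<^sup>2) = 1}"
      by (auto simp: coord_space_def)
    also have "closed \<dots>"
      by (intro closed_Int closed_INT ballI closed_Collect_eq continuous_intros)
         (auto intro!: continuous_on_product_coordinates)
    finally show ?thesis .
  qed
  ultimately show ?thesis
    using K compact_Int_closed[of ?K ?S] by (simp add: Int_absorb1)
qed

text \<open>The constant is the minimum of the form over the compact unit sphere; homogeneity of
  degree two carries the bound to all c.\<close>

lemma quadratic_form_coercive:
  fixes E :: "nat \<Rightarrow> nat \<Rightarrow> real"
  assumes pos: "\<And>c. \<exists>i<n. c i \<noteq> 0 \<Longrightarrow> 0 < (\<Sum>i<n. \<Sum>j<n. c i * c j * E i j)"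
  shows "\<exists>\<kappa>>0. \<forall>c. \<kappa> * (\<Sum>i<n. (c i)\<^sup>2) \<le> (\<Sum>i<n. \<Sum>j<n. c i * c j * E i j)"
proof (cases "n = 0")
  case True
  then show ?thesis by (intro exI[of _ 1]) simp
next
  case False
  let ?S = "{x \<in> coord_space n. (\<Sum>i<n. (x i)\<^sup>2) = 1}"
  let ?Q = "\<lambda>c. \<Sum>i<n. \<Sum>j<n. c i * c j * E i j"
  have ne: "?S \<noteq> {}"
  proof -
    have "(\<Sum>i<n. (if i = 0 then 1 else 0::real)\<^sup>2) = (\<Sum>i<n. if i = 0 then 1 else 0)"
      by (intro sum.cong) auto
    then have "(\<lambda>i. if i = 0 then 1 else 0) \<in> ?S"
      using False by (auto simp: coord_space_def)
    then show ?thesis by blast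
  qed
  have "continuous_on ?S ?Q"
    by (intro continuous_intros continuous_on_product_then_coordinatewise continuous_on_id)
  then obtain c0 where c0: "c0 \<in> ?S" "\<And>c. c \<in> ?S \<Longrightarrow> ?Q c0 \<le> ?Q c"
    using continuous_attains_inf[OF compact_unit_sphere_coord_space ne] by blast
  have "\<exists>i<n. c0 i \<noteq> 0"
  proof (rule ccontr)
    assume "\<not> ?thesis"
    then have "(\<Sum>i<n. (c0 i)\<^sup>2) = 0" by simp
    then show False using c0(1) by simp
  qed
  then have k: "0 < ?Q c0" using pos by blast
  have "?Q c0 * (\<Sum>i<n. (c i)\<^sup>2) \<le> ?Q c" for c
  proof (cases "(\<Sum>i<n. (c i)\<^sup>2) = 0")
    case True
    then have "\<And>i. i < n \<Longrightarrow> c i = 0" by (simp add: sum_nonneg_eq_0_iff)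
    then show ?thesis using True by simp
  next
    case s: False
    define s where "s = (\<Sum>i<n. (c i)\<^sup>2)"
    have s0: "s > 0" using s sum_nonneg[of "{..<n}" "\<lambda>i. (c i)\<^sup>2"] unfolding s_def by simp
    \<comment> \<open>The rescaled vector is cut off at n: the form reads only the first n entries,
      whereas lying in \<open>coord_space n\<close> also constrains the others.\<close>
    define d where "d = (\<lambda>i. if i < n then c i / sqrt s else 0)"
    have "(\<Sum>i<n. (d i)\<^sup>2) = (\<Sum>i<n. (c i)\<^sup>2 / s)"
      using s0 by (intro sum.cong) (auto simp: d_def power_divide)
    also have "\<dots> = 1" using s0 by (simp add: sum_divide_distrib[symmetric] s_def)
    finally have "d \<in> ?S" by (auto simp: d_def coord_space_def)
    then have "?Q c0 \<le> ?Q d" by (rule c0(2))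
    also have "?Q d = (\<Sum>i<n. \<Sum>j<n. c i * c j * E i j / s)"
      using s0 by (intro sum.cong) (auto simp: d_def field_simps power2_eq_square[symmetric])
    also have "\<dots> = ?Q c / s" by (simp add: sum_divide_distrib)
    finally show ?thesis using s0 by (simp add: field_simps s_def[symmetric])
  qed
  then show ?thesis using k by blast
qed

lemma integral_double_sum:
  fixes h :: "nat \<Rightarrow> nat \<Rightarrow> 'z \<Rightarrow> real"
  assumes "\<And>i j. i < n \<Longrightarrow> j < n \<Longrightarrow> integrable N (h i j)"
  shows "(\<integral>z. (\<Sum>j<n. \<Sum>i<n. r i j * h i j z) \<partial>N) = (\<Sum>j<n. \<Sum>i<n. r i j * (\<integral>z. h i j z \<partial>N))"
proof -
  have int: "integrable N (\<lambda>z. r i j * h i j z)" if "i < n" "j < n" for i j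
    using assms that by simp
  then have "integrable N (\<lambda>z. \<Sum>i<n. r i j * h i j z)" if "j < n" for j
    using that by (intro Bochner_Integration.integrable_sum) auto
  then have "(\<integral>z. (\<Sum>j<n. \<Sum>i<n. r i j * h i j z) \<partial>N) = (\<Sum>j<n. \<integral>z. (\<Sum>i<n. r i j * h i j z) \<partial>N)"
    by (intro Bochner_Integration.integral_sum) auto
  also have "\<dots> = (\<Sum>j<n. \<Sum>i<n. \<integral>z. r i j * h i j z \<partial>N)"
    using int by (intro sum.cong refl Bochner_Integration.integral_sum) auto
  finally show ?thesis by simp
qed

text \<open>Everything specific to splines is stripped off: \<phi> stands for the basis functions,
  \<open>p\<close> for their time derivatives, \<open>g\<close> for their gradients and
  \<open>lam\<close> for their spatial means. \<open>nonneg\<close> is the sign of the time term,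
  \<open>pos\<close> the definiteness of the Gram matrix of the gradients; together with a \<ge> m
  they make the residual point outwards on large spheres.\<close>

lemma abstract_galerkin:
  fixes N :: "'z measure" and \<phi> p lam :: "nat \<Rightarrow> 'z \<Rightarrow> real"
    and g :: "nat \<Rightarrow> 'z \<Rightarrow> 'e::euclidean_space" and a :: "real \<Rightarrow> real" and f :: "'z \<Rightarrow> real"
  assumes a_cont: "continuous_on UNIV a" and a_bd: "0 < m" "\<And>s. m \<le> a s" "\<And>s. a s \<le> K"
    and lam[measurable]: "\<And>i. i < n \<Longrightarrow> lam i \<in> borel_measurable N"
    and int_p: "\<And>i j. i < n \<Longrightarrow> j < n \<Longrightarrow> integrable N (\<lambda>z. p i z * \<phi> j z)"
    and int_g: "\<And>i j. i < n \<Longrightarrow> j < n \<Longrightarrow> integrable N (\<lambda>z. g i z \<bullet> g j z)"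
    and nonneg: "\<And>c. 0 \<le> (\<integral>z. (\<Sum>i<n. c i * p i z) * (\<Sum>j<n. c j * \<phi> j z) \<partial>N)"
    and pos: "\<And>c. (\<integral>z. (norm (\<Sum>i<n. c i *\<^sub>R g i z))\<^sup>2 \<partial>N) = 0 \<Longrightarrow> \<forall>i<n. c i = 0"
  shows "\<exists>c. \<forall>j<n. (\<integral>z. (\<Sum>i<n. c i * p i z) * \<phi> j z \<partial>N)
     + (\<integral>z. a (\<Sum>k<n. c k * lam k z) * ((\<Sum>i<n. c i *\<^sub>R g i z) \<bullet> g j z) \<partial>N)
     = (\<integral>z. f z * \<phi> j z \<partial>N)"
proof -
  have K: "0 \<le> K" using a_bd(1) a_bd(2,3)[of 0] by linarith
  have a_m[measurable]: "a \<in> borel_measurable borel"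
    using a_cont by (rule borel_measurable_continuous_onI)
  define ac where "ac c z = a (\<Sum>k<n. c k * lam k z)" for c z
  have ac_m[measurable]: "ac c \<in> borel_measurable N" for c
    unfolding ac_def by measurable
  have ac_bd: "\<bar>ac c z\<bar> \<le> K" for c z
    using a_bd(1) a_bd(2,3)[of "\<Sum>k<n. c k * lam k z"] by (simp add: ac_def)
  have int_ag: "integrable N (\<lambda>z. ac c z * (g i z \<bullet> g j z))" if "i < n" "j < n" for c i j
  proof (rule Bochner_Integration.integrable_bound[where f = "\<lambda>z. K * (g i z \<bullet> g j z)"])
    show "integrable N (\<lambda>z. K * (g i z \<bullet> g j z))" using int_g that by simp
    show "(\<lambda>z. ac c z * (g i z \<bullet> g j z)) \<in> borel_measurable N"
      using int_g[OF that] by (intro borel_measurable_times) auto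
    show "AE z in N. norm (ac c z * (g i z \<bullet> g j z)) \<le> norm (K * (g i z \<bullet> g j z))"
      using ac_bd K by (auto simp: abs_mult intro!: mult_right_mono)
  qed
  define A where "A i j = (\<integral>z. p i z * \<phi> j z \<partial>N)" for i j
  \<comment> \<open>The diffusion matrix with its coefficient frozen at c, the only nonlinear
    ingredient of the residual \<open>G\<close>.\<close>
  define B where "B c i j = (\<integral>z. ac c z * (g i z \<bullet> g j z) \<partial>N)" for c i j
  define E where "E i j = (\<integral>z. g i z \<bullet> g j z \<partial>N)" for i j
  define F where "F j = (\<integral>z. f z * \<phi> j z \<partial>N)" for j
  define G where "G c j = (\<Sum>i<n. c i * A i j) + (\<Sum>i<n. c i * B c i j) - F j" for c j
  have A_eq: "(\<integral>z. (\<Sum>i<n. c i * p i z) * \<phi> j z \<partial>N) = (\<Sum>i<n. c i * A i j)" if "j < n" for c j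
  proof -
    have "(\<integral>z. (\<Sum>i<n. c i * p i z) * \<phi> j z \<partial>N) = (\<integral>z. (\<Sum>i<n. c i * (p i z * \<phi> j z)) \<partial>N)"
      by (simp add: sum_distrib_right mult.assoc)
    also have "\<dots> = (\<Sum>i<n. c i * A i j)"
      using int_p that by (subst Bochner_Integration.integral_sum) (auto simp: A_def)
    finally show ?thesis .
  qed
  have AA_eq: "(\<integral>z. (\<Sum>i<n. c i * p i z) * (\<Sum>j<n. c j * \<phi> j z) \<partial>N) = (\<Sum>j<n. (\<Sum>i<n. c i * A i j) * c j)" for c
  proof -
    have "(\<integral>z. (\<Sum>i<n. c i * p i z) * (\<Sum>j<n. c j * \<phi> j z) \<partial>N)
        = (\<integral>z. (\<Sum>j<n. \<Sum>i<n. (c i * c j) * (p i z * \<phi> j z)) \<partial>N)"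
      unfolding sum_product by (subst sum.swap) (simp add: ac_simps)
    also have "\<dots> = (\<Sum>j<n. \<Sum>i<n. (c i * c j) * A i j)"
      unfolding A_def using int_p by (rule integral_double_sum)
    also have "\<dots> = (\<Sum>j<n. (\<Sum>i<n. c i * A i j) * c j)"
      by (simp add: sum_distrib_right sum_distrib_left ac_simps)
    finally show ?thesis .
  qed
  have B_eq: "(\<integral>z. ac c z * ((\<Sum>i<n. c i *\<^sub>R g i z) \<bullet> g j z) \<partial>N) = (\<Sum>i<n. c i * B c i j)" if "j < n" for c j
  proof -
    have "(\<integral>z. ac c z * ((\<Sum>i<n. c i *\<^sub>R g i z) \<bullet> g j z) \<partial>N)
        = (\<integral>z. (\<Sum>i<n. c i * (ac c z * (g i z \<bullet> g j z))) \<partial>N)"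
      by (simp add: inner_sum_left sum_distrib_left ac_simps)
    also have "\<dots> = (\<Sum>i<n. c i * B c i j)"
      using int_ag that by (subst Bochner_Integration.integral_sum) (auto simp: B_def)
    finally show ?thesis .
  qed
  have norm_eq: "(norm (\<Sum>i<n. c i *\<^sub>R g i z))\<^sup>2 = (\<Sum>j<n. \<Sum>i<n. (c i * c j) * (g i z \<bullet> g j z))" for c z
    unfolding power2_norm_eq_inner inner_sum_left inner_sum_right
    by (intro sum.cong refl) (simp add: ac_simps inner_commute)
  have int_norm: "integrable N (\<lambda>z. (norm (\<Sum>i<n. c i *\<^sub>R g i z))\<^sup>2)" for c
    unfolding norm_eq by (intro Bochner_Integration.integrable_sum Bochner_Integration.integrable_mult_right int_g) auto
  have E_eq: "(\<integral>z. (norm (\<Sum>i<n. c i *\<^sub>R g i z))\<^sup>2 \<partial>N) = (\<Sum>i<n. \<Sum>j<n. c i * c j * E i j)" for c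
  proof -
    have "(\<integral>z. (norm (\<Sum>i<n. c i *\<^sub>R g i z))\<^sup>2 \<partial>N) = (\<Sum>j<n. \<Sum>i<n. c i * c j * E i j)"
      unfolding norm_eq E_def using int_g by (rule integral_double_sum)
    then show ?thesis by (subst sum.swap)
  qed
  have BB: "m * (\<Sum>i<n. \<Sum>j<n. c i * c j * E i j) \<le> (\<Sum>j<n. (\<Sum>i<n. c i * B c i j) * c j)" for c
  proof -
    have eq: "ac c z * (norm (\<Sum>i<n. c i *\<^sub>R g i z))\<^sup>2 = (\<Sum>j<n. \<Sum>i<n. (c i * c j) * (ac c z * (g i z \<bullet> g j z)))" for z
      unfolding norm_eq by (simp add: sum_distrib_left ac_simps)
    have "m * (\<Sum>i<n. \<Sum>j<n. c i * c j * E i j) = (\<integral>z. m * (norm (\<Sum>i<n. c i *\<^sub>R g i z))\<^sup>2 \<partial>N)"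
      using E_eq by simp
    also have "\<dots> \<le> (\<integral>z. ac c z * (norm (\<Sum>i<n. c i *\<^sub>R g i z))\<^sup>2 \<partial>N)"
    proof (rule integral_mono)
      show "integrable N (\<lambda>z. m * (norm (\<Sum>i<n. c i *\<^sub>R g i z))\<^sup>2)" using int_norm by simp
      show "integrable N (\<lambda>z. ac c z * (norm (\<Sum>i<n. c i *\<^sub>R g i z))\<^sup>2)"
        unfolding eq by (intro Bochner_Integration.integrable_sum Bochner_Integration.integrable_mult_right int_ag) auto
    qed (auto simp: ac_def a_bd intro!: mult_right_mono)
    also have "\<dots> = (\<Sum>j<n. \<Sum>i<n. (c i * c j) * B c i j)"
      unfolding eq B_def using int_ag by (rule integral_double_sum)
    also have "\<dots> = (\<Sum>j<n. (\<Sum>i<n. c i * B c i j) * c j)"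
      by (simp add: sum_distrib_right sum_distrib_left ac_simps)
    finally show ?thesis .
  qed
  \<comment> \<open>Convergence of c moves only the argument of a. The majorant K |g_i . g_j| is
    integrable and independent of c, so dominated convergence applies.\<close>
  have B_cont: "continuous_on (coord_space n) (\<lambda>c. B c i j)" if ij: "i < n" "j < n" for i j
  proof (rule continuous_on_sequentiallyI)
    fix u :: "nat \<Rightarrow> nat \<Rightarrow> real" and c assume u: "u \<longlonglongrightarrow> c"
    have uk: "(\<lambda>n. u n k) \<longlonglongrightarrow> c k" for k
      using u continuous_on_tendsto_compose[OF continuous_on_product_coordinates[of k]] by simp
    show "(\<lambda>n. B (u n) i j) \<longlonglongrightarrow> B c i j"
      unfolding B_def
    proof (rule integral_dominated_convergence[where w = "\<lambda>z. K * \<bar>g i z \<bullet> g j z\<bar>"])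
      show "(\<lambda>z. ac c z * (g i z \<bullet> g j z)) \<in> borel_measurable N"
        "(\<lambda>z. ac (u k) z * (g i z \<bullet> g j z)) \<in> borel_measurable N" for k
        using int_ag[OF ij] by auto
      show "integrable N (\<lambda>z. K * \<bar>g i z \<bullet> g j z\<bar>)" using int_g[OF ij] by simp
      show "AE z in N. norm (ac (u k) z * (g i z \<bullet> g j z)) \<le> K * \<bar>g i z \<bullet> g j z\<bar>" for k
        using ac_bd by (auto simp: abs_mult intro!: mult_right_mono)
      have "isCont a s" for s using a_cont by (simp add: continuous_on_eq_continuous_at)
      then show "AE z in N. (\<lambda>k. ac (u k) z * (g i z \<bullet> g j z)) \<longlonglongrightarrow> ac c z * (g i z \<bullet> g j z)"
        unfolding ac_def
        by (intro always_eventually allI tendsto_mult tendsto_const isCont_tendsto_compose[of _ a] tendsto_sum uk)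
    qed
  qed
  have "\<exists>i<n. c i \<noteq> 0 \<Longrightarrow> 0 < (\<Sum>i<n. \<Sum>j<n. c i * c j * E i j)" for c
  proof -
    assume "\<exists>i<n. c i \<noteq> 0"
    then have "(\<integral>z. (norm (\<Sum>i<n. c i *\<^sub>R g i z))\<^sup>2 \<partial>N) \<noteq> 0" using pos by blast
    moreover have "0 \<le> (\<integral>z. (norm (\<Sum>i<n. c i *\<^sub>R g i z))\<^sup>2 \<partial>N)" by simp
    ultimately show ?thesis unfolding E_eq by linarith
  qed
  from quadratic_form_coercive[OF this]
  obtain \<kappa> where k: "\<kappa> > 0" "\<And>c. \<kappa> * (\<Sum>i<n. (c i)\<^sup>2) \<le> (\<Sum>i<n. \<Sum>j<n. c i * c j * E i j)"
    by blast
  \<comment> \<open>Chosen so that m \<kappa> R exceeds the sum of the |F_j| by 1. On the sphere of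
    radius R the diffusion term is then at least m \<kappa> R^2, which beats the load, at most R
    times that sum. The added 1 makes this strict and keeps R positive for zero load.\<close>
  define R where "R = ((\<Sum>j<n. \<bar>F j\<bar>) + 1) / (m * \<kappa>)"
  have R0: "R > 0"
    unfolding R_def using k a_bd by (intro divide_pos_pos add_nonneg_pos sum_nonneg) auto
  have "\<exists>c\<in>coord_space n. \<forall>j<n. G c j = 0"
  proof (rule outward_field_has_zero)
    fix j assume "j < n"
    then show "continuous_on (coord_space n) (\<lambda>c. G c j)"
      unfolding G_def
      by (intro continuous_intros B_cont continuous_on_product_then_coordinatewise continuous_on_id) auto
  next
    fix c assume c: "c \<in> coord_space n" "(\<Sum>i<n. (c i)\<^sup>2) = R\<^sup>2"
    have cR: "\<bar>c j\<bar> \<le> R" if "j < n" for j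
    proof -
      have "(c j)\<^sup>2 \<le> R\<^sup>2" unfolding c(2)[symmetric] using that by (intro member_le_sum) auto
      then show ?thesis using R0 abs_le_square_iff[of "c j" R] by simp
    qed
    have "F j * c j \<le> \<bar>F j\<bar> * R" if "j < n" for j
    proof -
      have "F j * c j \<le> \<bar>F j\<bar> * \<bar>c j\<bar>" by (metis abs_ge_self abs_mult)
      also have "\<dots> \<le> \<bar>F j\<bar> * R" using cR[OF that] by (rule mult_left_mono) simp
      finally show ?thesis .
    qed
    then have "(\<Sum>j<n. F j * c j) \<le> (\<Sum>j<n. \<bar>F j\<bar> * R)"
      by (intro sum_mono) auto
    also have "\<dots> < m * (\<kappa> * R\<^sup>2)"
    proof -
      have "m * (\<kappa> * R\<^sup>2) = R * (m * \<kappa> * R)" by (simp add: power2_eq_square)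
      also have "m * \<kappa> * R = (\<Sum>j<n. \<bar>F j\<bar>) + 1" unfolding R_def using k a_bd by simp
      finally show ?thesis using R0 by (simp add: sum_distrib_left distrib_left mult.commute)
    qed
    also have "\<dots> \<le> m * (\<Sum>i<n. \<Sum>j<n. c i * c j * E i j)"
      using k(2)[of c] a_bd(1) by (simp add: c(2))
    also have "\<dots> \<le> (\<Sum>j<n. (\<Sum>i<n. c i * B c i j) * c j)" by (rule BB)
    finally have "(\<Sum>j<n. F j * c j) < (\<Sum>j<n. (\<Sum>i<n. c i * B c i j) * c j)" .
    moreover have "(\<Sum>j<n. G c j * c j) = (\<Sum>j<n. (\<Sum>i<n. c i * A i j) * c j)
        + (\<Sum>j<n. (\<Sum>i<n. c i * B c i j) * c j) - (\<Sum>j<n. F j * c j)"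
      by (simp only: G_def distrib_right left_diff_distrib sum.distrib sum_subtractf)
    ultimately show "0 < (\<Sum>j<n. G c j * c j)"
      using nonneg[of c] unfolding AA_eq by linarith
  qed
  then obtain c where "\<forall>j<n. G c j = 0" by blast
  then have "\<forall>j<n. (\<integral>z. (\<Sum>i<n. c i * p i z) * \<phi> j z \<partial>N)
     + (\<integral>z. ac c z * ((\<Sum>i<n. c i *\<^sub>R g i z) \<bullet> g j z) \<partial>N) = (\<integral>z. f z * \<phi> j z \<partial>N)"
    using A_eq B_eq by (simp add: G_def F_def)
  then show ?thesis unfolding ac_def by blast
qed

section \<open>Univariate B-splines\<close>

lemma nth_le_last:
  fixes Z :: "'a::linorder list"
  assumes "sorted Z" "l < length Z"
  shows "Z!l \<le> last Z"
proof -
  have "Z \<noteq> []" using assms(2) by auto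
  then show ?thesis
    using sorted_nth_mono[OF assms(1), of l "length Z - 1"] assms(2) by (simp add: last_conv_nth)
qed

text \<open>The clause that closes the last span on the right cannot fire here, because x lies
  strictly below the last knot.\<close>

lemma bspline_0_on_span:
  assumes "sorted Z" "l + 1 < length Z" "i + 1 < length Z" "Z!l \<le> x" "x < Z!(l+1)"
  shows "bspline Z 0 i x = (if i = l then 1 else 0)"
proof -
  have last: "x < last Z"
    using assms nth_le_last[OF assms(1), of "l+1"] by simp
  consider "i < l" | "i = l" | "l < i" by linarith
  then show ?thesis
  proof cases
    case 1
    then have "Z!(i+1) \<le> Z!l" using assms by (intro sorted_nth_mono) auto
    then show ?thesis using 1 last assms by auto
  next
    case 2
    then show ?thesis using assms by simp
  next
    case 3
    then have "Z!(l+1) \<le> Z!i" using assms by (intro sorted_nth_mono) auto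
    then show ?thesis using 3 last assms by auto
  qed
qed

lemma bspline_eq_poly_on_span:
  assumes "sorted Z" "l + 1 < length Z" "i + p + 1 < length Z"
  shows "\<exists>P::real poly. \<forall>x\<in>{Z!l..<Z!(l+1)}. bspline Z p i x = poly P x"
  using assms(3)
proof (induction p arbitrary: i)
  case 0
  then show ?case
    using bspline_0_on_span[OF assms(1,2), of i] by (intro exI[of _ "[:if i = l then 1 else 0:]"]) auto
next
  case (Suc p)
  have "i + p + 1 < length Z" "i + 1 + p + 1 < length Z" using Suc.prems by auto
  then obtain P Q :: "real poly" where
    P: "\<forall>x\<in>{Z!l..<Z!(l+1)}. bspline Z p i x = poly P x" and
    Q: "\<forall>x\<in>{Z!l..<Z!(l+1)}. bspline Z p (i+1) x = poly Q x"
    using Suc.IH by meson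
  show ?case
    \<comment> \<open>A repeated knot makes the constant factor 1/0 = 0, exactly as in the
      recursion, so no case distinction is needed.\<close>
    by (rule exI[of _ "[:1 / (Z!(i+p+1) - Z!i):] * ([:- (Z!i), 1:] * P)
        + [:1 / (Z!(i+p+2) - Z!(i+1)):] * ([:Z!(i+p+2), -1:] * Q)"])
      (use P Q in \<open>auto simp: algebra_simps diff_divide_distrib add_divide_distrib\<close>)
qed

lemma open_knots_maxregD:
  assumes "open_knots_maxreg q Z"
  shows "sorted Z" "length Z = nbasis Z q + q + 1" "q < nbasis Z q" "Z!0 = 0" "last Z = 1"
    "\<And>i. i \<le> q \<Longrightarrow> Z!i = 0" "\<And>i. nbasis Z q \<le> i \<Longrightarrow> i \<le> nbasis Z q + q \<Longrightarrow> Z!i = 1"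
    "\<And>i. q \<le> i \<Longrightarrow> i < nbasis Z q \<Longrightarrow> Z!i < Z!(i+1)"
proof -
  note a = assms[unfolded open_knots_maxreg_def Let_def]
  show s: "sorted Z" and l: "length Z = nbasis Z q + q + 1" using a by auto
  show z: "\<And>i. i \<le> q \<Longrightarrow> Z!i = 0" using a by auto
  show o: "Z!i = 1" if "nbasis Z q \<le> i" "i \<le> nbasis Z q + q" for i
    using a that by (metis add_diff_inverse_nat add_le_cancel_left not_le)
  \<comment> \<open>Otherwise the knot with index q would be both 0 and 1.\<close>
  show "q < nbasis Z q"
  proof (rule ccontr)
    assume "\<not> q < nbasis Z q"
    then show False using z[of q] o[of q] by auto
  qed
  show "Z!0 = 0" using z by simp
  show "last Z = 1"
    using o[of "nbasis Z q + q"] l by (subst last_conv_nth) auto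
  show "\<And>i. q \<le> i \<Longrightarrow> i < nbasis Z q \<Longrightarrow> Z!i < Z!(i+1)" using a by auto
qed

text \<open>A hat function jumps only where one of its legs collapses onto a repeated knot. Maximal
  regularity allows repeated knots only at 0 and 1, so such a jump sits at an end point and is
  invisible from inside [0,1].\<close>

lemma bspline_degree_1_continuous:
  assumes K: "open_knots_maxreg q Z" and i: "i + 2 < length Z" and q: "q \<ge> 1"
  shows "continuous_on {0..1} (bspline Z 1 i)"
proof -
  note D = open_knots_maxregD[OF K]
  define a b c where "a = Z!i" and "b = Z!(i+1)" and "c = Z!(i+2)"
  have ab: "a \<le> b" and bc: "b \<le> c" and c1: "c \<le> 1" and a0: "0 \<le> a"
    using sorted_nth_mono[OF D(1), of i "i+1"] sorted_nth_mono[OF D(1), of "i+1" "i+2"]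
      nth_le_last[OF D(1), of "i+2"] sorted_nth_mono[OF D(1), of 0 i] i D(4,5)
    by (auto simp: a_def b_def c_def)
  have B: "bspline Z 1 i x = (x - a) / (b - a) * (if (a \<le> x \<and> x < b) \<or> (a < b \<and> x = b \<and> b = 1) then 1 else 0)
     + (c - x) / (c - b) * (if (b \<le> x \<and> x < c) \<or> (b < c \<and> x = c \<and> c = 1) then 1 else 0)" for x
    by (simp add: a_def b_def c_def D(5))
  have left: "a = 0" if "a = b" "b < c"
  proof -
    have "\<not> (q \<le> i \<and> i < nbasis Z q)" using D(8)[of i] that by (auto simp: a_def b_def)
    moreover have "i < nbasis Z q"
      using D(7)[of i] D(7)[of "i+1"] that i D(2) c1 by (force simp: a_def b_def)
    ultimately show ?thesis using D(6)[of i] by (auto simp: a_def)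
  qed
  have right: "b = 1" if "a < b" "b = c"
  proof -
    have "\<not> (q \<le> i+1 \<and> i+1 < nbasis Z q)" using D(8)[of "i+1"] that by (auto simp: b_def c_def)
    moreover have "q \<le> i + 1"
      using D(6)[of "i+1"] that a0 by (force simp: b_def)
    ultimately show ?thesis using D(7)[of "i+1"] D(2) i by (auto simp: b_def)
  qed
  consider "a < b" "b < c" | "a = b" "b < c" | "a < b" "b = c" | "a = b" "b = c"
    using ab bc by linarith
  then show ?thesis
  proof cases
    case 1
    \<comment> \<open>The minimum of the rising and the falling line, cut off at 0, describes the
      whole hat by one continuous formula.\<close>
    have eq: "bspline Z 1 i x = max 0 (min ((x - a) / (b - a)) ((c - x) / (c - b)))" if "x \<in> {0..1}" for x
    proof -
      consider "x < a" | "a \<le> x" "x < b" | "b \<le> x" "x < c" | "x = c" | "c < x" by linarith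
      then show ?thesis
      proof cases
        case p: 1
        then have "(x - a) / (b - a) < 0" using 1 by (simp add: divide_neg_pos)
        then show ?thesis using p 1 unfolding B by auto
      next
        case p: 2
        then have le: "(x - a) / (b - a) \<le> 1" "1 \<le> (c - x) / (c - b)" "0 \<le> (x - a) / (b - a)" using 1 by auto
        then have "min ((x - a) / (b - a)) ((c - x) / (c - b)) = (x - a) / (b - a)" by linarith
        with le show ?thesis using p 1 c1 unfolding B by auto
      next
        case p: 3
        then have le: "1 \<le> (x - a) / (b - a)" "(c - x) / (c - b) \<le> 1" "0 \<le> (c - x) / (c - b)" using 1 by auto
        then have "min ((x - a) / (b - a)) ((c - x) / (c - b)) = (c - x) / (c - b)" by linarith
        with le show ?thesis using p 1 c1 unfolding B by auto
      next
        case p: 4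
        then show ?thesis using 1 unfolding B by auto
      next
        case p: 5
        then have "(c - x) / (c - b) < 0" using 1 by (simp add: divide_neg_pos)
        then show ?thesis using p 1 unfolding B by auto
      qed
    qed
    have "continuous_on {0..1} (\<lambda>x. max 0 (min ((x - a) / (b - a)) ((c - x) / (c - b))))"
      using 1 by (intro continuous_intros) auto
    then show ?thesis by (rule continuous_on_eq) (simp only: eq)
  next
    case 2
    have eq: "bspline Z 1 i x = max 0 ((c - x) / (c - b))" if "x \<in> {0..1}" for x
      using 2 left[OF 2] that c1 unfolding B by (cases "x < c") (auto simp: max_def zero_le_divide_iff)
    have "continuous_on {0..1} (\<lambda>x. max 0 ((c - x) / (c - b)))"
      using 2 by (intro continuous_intros) auto
    then show ?thesis by (rule continuous_on_eq) (simp only: eq)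
  next
    case 3
    \<comment> \<open>The falling leg is missing and the peak is at 1. The value there is 1 because
      the last span is closed on the right; a half-open span would give 0.\<close>
    have eq: "bspline Z 1 i x = max 0 ((x - a) / (b - a))" if "x \<in> {0..1}" for x
      using 3 right[OF 3] that c1 unfolding B by (cases "x < a") (auto simp: max_def zero_le_divide_iff)
    have "continuous_on {0..1} (\<lambda>x. max 0 ((x - a) / (b - a)))"
      using 3 by (intro continuous_intros) auto
    then show ?thesis by (rule continuous_on_eq) (simp only: eq)
  next
    case 4
    have "bspline Z 1 i = (\<lambda>_. 0)"
      using 4 unfolding B fun_eq_iff by auto
    then show ?thesis by simp
  qed
qed

lemma bspline_continuous:
  assumes K: "open_knots_maxreg q Z" and q: "q \<ge> 1" and p: "p \<ge> 1" and i: "i + p + 1 < length Z"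
  shows "continuous_on {0..1} (bspline Z p i)"
  using p i
proof (induction p arbitrary: i rule: nat_induct_at_least)
  case base
  then show ?case using bspline_degree_1_continuous[OF K _ q] by simp
next
  case (Suc p)
  have "bspline Z (Suc p) i = (\<lambda>x. (x - Z!i) / (Z!(i+p+1) - Z!i) * bspline Z p i x
     + (Z!(i+p+2) - x) / (Z!(i+p+2) - Z!(i+1)) * bspline Z p (i+1) x)"
    by (simp add: fun_eq_iff)
  moreover have "continuous_on {0..1} (bspline Z p i)" "continuous_on {0..1} (bspline Z p (i+1))"
    using Suc.IH[of i] Suc.IH[of "i+1"] Suc.prems by auto
  \<comment> \<open>The denominators do not depend on x. Division by a zero one is multiplication by
    0, so the affine factors are continuous in every case.\<close>
  ultimately show ?case
    by (simp add: divide_inverse continuous_intros)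
qed

section \<open>Smoothness of B-splines inside the knot spans\<close>

definition knot_free :: "real list \<Rightarrow> real set" where
  "knot_free Z = {0<..<1} - set Z"

lemma open_knot_free: "open (knot_free Z)"
  unfolding knot_free_def by (intro open_Diff finite_imp_closed) auto

lemma ex_span:
  assumes "open_knots_maxreg q Z" "0 \<le> x" "x < 1"
  shows "\<exists>l. l + 1 < length Z \<and> Z!l \<le> x \<and> x < Z!(l+1)"
proof -
  note D = open_knots_maxregD[OF assms(1)]
  \<comment> \<open>Taking the largest index skips over repeated knots, so the span starting there
    is nonempty. It is not the last index of the list, since the last knot is 1 and x < 1.\<close>
  define A where "A = {l. l < length Z \<and> Z!l \<le> x}"
  have A: "finite A" "A \<noteq> {}" using assms D(2,4) by (auto simp: A_def intro: exI[of _ 0])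
  have M: "Max A \<in> A" using Max_in[OF A] .
  have "Max A \<noteq> length Z - 1"
    using M assms(3) D(7)[of "nbasis Z q + q"] D(2) by (auto simp: A_def)
  then have l: "Max A + 1 < length Z" using M by (auto simp: A_def)
  have "Max A + 1 \<notin> A" using Max_ge[OF A(1)] by fastforce
  then show ?thesis using l M by (auto simp: A_def)
qed

lemma knot_free_iff_span:
  assumes "open_knots_maxreg q Z"
  shows "x \<in> knot_free Z \<longleftrightarrow> (\<exists>l. l + 1 < length Z \<and> Z!l < x \<and> x < Z!(l+1))"
proof
  assume x: "x \<in> knot_free Z"
  then obtain l where l: "l + 1 < length Z" "Z!l \<le> x" "x < Z!(l+1)"
    using ex_span[OF assms, of x] by (auto simp: knot_free_def)
  moreover have "Z!l \<noteq> x" using x l by (auto simp: knot_free_def)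
  ultimately show "\<exists>l. l + 1 < length Z \<and> Z!l < x \<and> x < Z!(l+1)" by force
next
  note D = open_knots_maxregD[OF assms(1)]
  assume "\<exists>l. l + 1 < length Z \<and> Z!l < x \<and> x < Z!(l+1)"
  then obtain l where l: "l + 1 < length Z" "Z!l < x" "x < Z!(l+1)" by blast
  have "0 \<le> Z!l" "Z!(l+1) \<le> 1"
    using sorted_nth_mono[OF D(1), of 0 l] nth_le_last[OF D(1), of "l+1"] D(4,5) l
    by auto
  moreover have "x \<notin> set Z"
  proof
    assume "x \<in> set Z"
    then obtain j where j: "j < length Z" "x = Z!j" by (auto simp: in_set_conv_nth)
    consider "j \<le> l" | "l + 1 \<le> j" by linarith
    then show False
      using sorted_nth_mono[OF D(1), of j l] sorted_nth_mono[OF D(1), of "l+1" j] l j by cases auto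
  qed
  ultimately show "x \<in> knot_free Z" using l by (auto simp: knot_free_def)
qed

text \<open>Around a point strictly inside a span the B-spline coincides with a polynomial on an
  open interval, and both claims are local.\<close>

lemma bspline_deriv_knot_free:
  assumes K: "open_knots_maxreg q Z" and i: "i < nbasis Z q" and x: "x \<in> knot_free Z"
  shows "(bspline Z q i has_real_derivative deriv (bspline Z q i) x) (at x)"
    and "isCont (deriv (bspline Z q i)) x"
proof -
  note D = open_knots_maxregD[OF K]
  obtain l where l: "l + 1 < length Z" "Z!l < x" "x < Z!(l+1)"
    using x knot_free_iff_span[OF K] by blast
  obtain P where P: "\<And>y. y \<in> {Z!l<..<Z!(l+1)} \<Longrightarrow> bspline Z q i y = poly P y"
    using bspline_eq_poly_on_span[OF D(1) l(1), of i q] i D(2) by force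
  have der: "(bspline Z q i has_real_derivative poly (pderiv P) y) (at y)" if "y \<in> {Z!l<..<Z!(l+1)}" for y
    by (rule DERIV_cong_ev[OF refl _ refl, THEN iffD2, OF _ poly_DERIV])
      (rule eventually_mono[OF eventually_nhds_in_open[of "{Z!l<..<Z!(l+1)}"]], use that P in auto)
  then show "(bspline Z q i has_real_derivative deriv (bspline Z q i) x) (at x)"
    using l DERIV_imp_deriv by fastforce
  have "eventually (\<lambda>y. deriv (bspline Z q i) y = poly (pderiv P) y) (nhds x)"
    by (rule eventually_mono[OF eventually_nhds_in_open[of "{Z!l<..<Z!(l+1)}"]])
      (use l der DERIV_imp_deriv in auto)
  then show "isCont (deriv (bspline Z q i)) x"
    using isCont_cong poly_isCont by metis
qed

text \<open>There are finitely many spans, and on each the derivative is that of one polynomial,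
  bounded on the closed span.\<close>

lemma bspline_deriv_bounded:
  assumes K: "open_knots_maxreg q Z" and i: "i < nbasis Z q"
  shows "bounded (deriv (bspline Z q i) ` knot_free Z)"
proof -
  note D = open_knots_maxregD[OF K]
  have "bounded (deriv (bspline Z q i) ` {Z!l<..<Z!(l+1)})" if l: "l + 1 < length Z" for l
  proof -
    obtain P where P: "\<And>y. y \<in> {Z!l<..<Z!(l+1)} \<Longrightarrow> bspline Z q i y = poly P y"
      using bspline_eq_poly_on_span[OF D(1) l(1), of i q] i D(2) by force
    have der: "(bspline Z q i has_real_derivative poly (pderiv P) y) (at y)" if "y \<in> {Z!l<..<Z!(l+1)}" for y
      by (rule DERIV_cong_ev[OF refl _ refl, THEN iffD2, OF _ poly_DERIV])
        (rule eventually_mono[OF eventually_nhds_in_open[of "{Z!l<..<Z!(l+1)}"]], use that P in auto)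
    have "deriv (bspline Z q i) ` {Z!l<..<Z!(l+1)} = poly (pderiv P) ` {Z!l<..<Z!(l+1)}"
      using der DERIV_imp_deriv by (intro image_cong) auto
    also have "\<dots> \<subseteq> poly (pderiv P) ` {Z!l..Z!(l+1)}" by auto
    finally show ?thesis
      by (rule bounded_subset[rotated])
        (intro compact_imp_bounded compact_continuous_image continuous_intros compact_Icc)
  qed
  then have "bounded (\<Union>l\<in>{..<length Z - 1}. deriv (bspline Z q i) ` {Z!l<..<Z!(l+1)})"
    by (intro bounded_UN) auto
  then show ?thesis
  proof (rule bounded_subset, intro image_subsetI)
    fix x assume "x \<in> knot_free Z"
    then obtain l where "l + 1 < length Z" "Z!l < x" "x < Z!(l+1)"
      using knot_free_iff_span[OF K] by blast
    then show "deriv (bspline Z q i) x \<in> (\<Union>l\<in>{..<length Z - 1}. deriv (bspline Z q i) ` {Z!l<..<Z!(l+1)})"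
      by (intro UN_I[of l]) auto
  qed
qed

section \<open>Measurability of directional derivatives\<close>

text \<open>True also without differentiability: \<open>deriv\<close> chooses among the numbers that
  are derivatives, and both sides choose by the same predicate.\<close>

lemma deriv_shift_0: "deriv f x = deriv (\<lambda>s. f (x + s)) 0"
  for f :: "real \<Rightarrow> real"
  unfolding deriv_def using DERIV_shift[of f _ 0 x] by (simp add: add.commute)

text \<open>The Cauchy criterion for difference quotients, tested on rational increments only. This
  makes differentiability a countable condition on the base point, hence a measurable one;
  continuity of \<open>q\<close> off 0 extends the estimate from rational to real
  increments.\<close>

lemma tendsto_at_0_iff_Cauchy_Rats:
  fixes q :: "real \<Rightarrow> real"
  assumes e: "e > 0" and cont: "\<And>h. 0 < \<bar>h\<bar> \<Longrightarrow> \<bar>h\<bar> < e \<Longrightarrow> isCont q h"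
  shows "(\<exists>D. (q \<longlongrightarrow> D) (at 0)) \<longleftrightarrow>
    (\<forall>k::nat. \<exists>n::nat. \<forall>h\<in>\<rat>. \<forall>h'\<in>\<rat>. h \<noteq> 0 \<longrightarrow> h' \<noteq> 0 \<longrightarrow> \<bar>h\<bar> < 1 / Suc n \<longrightarrow> \<bar>h'\<bar> < 1 / Suc n \<longrightarrow>
        \<bar>q h - q h'\<bar> \<le> 1 / Suc k)" (is "?L \<longleftrightarrow> ?R")
proof
  assume ?L
  then obtain D where D: "(q \<longlongrightarrow> D) (at 0)" by blast
  show ?R
  proof
    fix k :: nat
    have "0 < 1 / (2 * real (Suc k))" by simp
    from D[unfolded tendsto_iff, rule_format, OF this]
    obtain d where d: "d > 0" "\<And>h. h \<noteq> 0 \<Longrightarrow> \<bar>h\<bar> < d \<Longrightarrow> \<bar>q h - D\<bar> < 1 / (2 * real (Suc k))"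
      by (auto simp: eventually_at dist_real_def)
    obtain n where n: "1 / real (Suc n) < d"
      using d(1) nat_approx_posE by blast
    have "\<bar>q h - q h'\<bar> \<le> 1 / Suc k"
      if "h \<noteq> 0" "h' \<noteq> 0" "\<bar>h\<bar> < 1 / Suc n" "\<bar>h'\<bar> < 1 / Suc n" for h h'
    proof -
      have "\<bar>q h - q h'\<bar> \<le> \<bar>q h - D\<bar> + \<bar>q h' - D\<bar>" by linarith
      also have "\<dots> \<le> 1 / (2 * real (Suc k)) + 1 / (2 * real (Suc k))"
        using d(2)[of h] d(2)[of h'] that n by linarith
      also have "\<dots> = 1 / Suc k" by (simp add: field_simps)
      finally show ?thesis .
    qed
    then show "\<exists>n::nat. \<forall>h\<in>\<rat>. \<forall>h'\<in>\<rat>. h \<noteq> 0 \<longrightarrow> h' \<noteq> 0 \<longrightarrow> \<bar>h\<bar> < 1 / Suc n \<longrightarrow> \<bar>h'\<bar> < 1 / Suc n \<longrightarrow>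
        \<bar>q h - q h'\<bar> \<le> 1 / Suc k" by blast
  qed
next
  assume R: ?R
  have approx: "\<exists>g. (\<forall>n. g n \<in> \<rat> \<and> g n \<noteq> 0 \<and> \<bar>g n\<bar> < d) \<and> g \<longlonglongrightarrow> h"
    if "h \<noteq> 0" "\<bar>h\<bar> < d" for h d :: real
  proof -
    let ?A = "{x. x \<in> \<rat> \<and> x \<noteq> 0 \<and> \<bar>x\<bar> < d}"
    have "h \<in> closure ?A"
      unfolding closure_approachable
    proof (intro allI impI)
      fix r :: real assume r: "r > 0"
      \<comment> \<open>Staying within |h| of h keeps the rational point away from 0, staying within
        d - |h| keeps it inside the radius d.\<close>
      define s where "s = min r (min \<bar>h\<bar> (d - \<bar>h\<bar>))"
      have s: "s > 0" "s \<le> r" "s \<le> \<bar>h\<bar>" "s \<le> d - \<bar>h\<bar>" using r that by (auto simp: s_def)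
      obtain x where "x \<in> \<rat>" "h - s < x" "x < h + s"
        using Rats_dense_in_real[of "h - s" "h + s"] s(1) by auto
      then show "\<exists>y\<in>?A. dist y h < r"
        using s by (intro bexI[of _ x]) (auto simp: dist_real_def abs_if split: if_splits)
    qed
    then show ?thesis unfolding closure_sequential by blast
  qed
  have "\<exists>x. filtermap q (at 0) \<le> nhds x"
  proof (rule cauchy_filter_complete_converges[OF _ complete_UNIV, simplified])
    show "filtermap q (at 0) \<noteq> bot" by (simp add: filtermap_bot_iff)
    show "cauchy_filter (filtermap q (at 0))"
      unfolding cauchy_filter_metric_filtermap
    proof (intro allI impI)
      fix ee :: real assume "0 < ee"
      then obtain k where k: "1 / real (Suc k) < ee" using nat_approx_posE by blast
      obtain n where n: "\<And>h h'. h \<in> \<rat> \<Longrightarrow> h' \<in> \<rat> \<Longrightarrow> h \<noteq> 0 \<Longrightarrow> h' \<noteq> 0 \<Longrightarrow> \<bar>h\<bar> < 1 / Suc n \<Longrightarrow>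
         \<bar>h'\<bar> < 1 / Suc n \<Longrightarrow> \<bar>q h - q h'\<bar> \<le> 1 / Suc k" using R by meson
      \<comment> \<open>Below e the quotient is continuous, below 1/(n+1) the rational Cauchy
        estimate holds.\<close>
      define d where "d = min e (1 / Suc n)"
      have dpos: "d > 0" using e by (simp add: d_def)
      have "\<bar>q h - q h'\<bar> \<le> 1 / Suc k" if h: "h \<noteq> 0" "\<bar>h\<bar> < d" and h': "h' \<noteq> 0" "\<bar>h'\<bar> < d" for h h'
      proof -
        obtain g where g: "\<And>n. g n \<in> \<rat> \<and> g n \<noteq> 0 \<and> \<bar>g n\<bar> < d" "g \<longlonglongrightarrow> h"
          using approx[OF h] by blast
        obtain g' where g': "\<And>n. g' n \<in> \<rat> \<and> g' n \<noteq> 0 \<and> \<bar>g' n\<bar> < d" "g' \<longlonglongrightarrow> h'"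
          using approx[OF h'] by blast
        have "(\<lambda>n. \<bar>q (g n) - q (g' n)\<bar>) \<longlonglongrightarrow> \<bar>q h - q h'\<bar>"
          using h h' by (intro tendsto_intros isCont_tendsto_compose[OF cont g(2)] isCont_tendsto_compose[OF cont g'(2)])
            (auto simp: d_def)
        then show ?thesis
          by (rule LIMSEQ_le_const2) (use n g(1) g'(1) in \<open>auto simp: d_def\<close>)
      qed
      then have "dist (q h) (q h') < ee" if "h \<noteq> 0 \<and> \<bar>h\<bar> < d" "h' \<noteq> 0 \<and> \<bar>h'\<bar> < d" for h h'
        using that k unfolding dist_real_def by (meson le_less_trans)
      moreover have "eventually (\<lambda>h. h \<noteq> 0 \<and> \<bar>h\<bar> < d) (at 0)"
        unfolding eventually_at using dpos by (intro exI[of _ d]) (simp add: dist_real_def)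
      ultimately show "\<exists>P. eventually P (at 0) \<and> (\<forall>x y. P x \<and> P y \<longrightarrow> dist (q x) (q y) < ee)"
        by (intro exI[of _ "\<lambda>h. h \<noteq> 0 \<and> \<bar>h\<bar> < d"] conjI allI impI) simp_all
    qed
  qed
  then show ?L by (auto simp: filterlim_def)
qed

text \<open>A non-measurable integrand would have integral \<open>0\<close> by convention, so measurability is also
  needed at the points where the function is not differentiable.\<close>

lemma borel_measurable_directional_deriv:
  fixes g :: "'a::euclidean_space \<Rightarrow> real"
  assumes W: "open W" and g: "continuous_on W g"
  shows "(\<lambda>x. indicator W x * deriv (\<lambda>s. g (x + s *\<^sub>R e)) 0) \<in> borel_measurable borel"
proof -
  \<comment> \<open>Extended by 0, the function is Borel on the whole space, and so are its
    difference quotients. Close to a point of the open set \<open>W\<close> they equal those of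
    \<open>g\<close>.\<close>
  define gt where "gt x = indicator W x * g x" for x
  have gt_m[measurable]: "gt \<in> borel_measurable borel"
    using borel_measurable_continuous_on_indicator[OF _ g] W
    by (simp add: gt_def[abs_def] scaleR_conv_of_real)
  define Q where "Q h x = (gt (x + h *\<^sub>R e) - gt x) / h" for h x
  have Q_m[measurable]: "Q h \<in> borel_measurable borel" for h
    unfolding Q_def by measurable
  have sh[measurable]: "W \<in> sets borel" using W by simp
  define C where "C x \<longleftrightarrow> (\<forall>k::nat. \<exists>n::nat. \<forall>h\<in>\<rat>. \<forall>h'\<in>\<rat>. h \<noteq> 0 \<longrightarrow> h' \<noteq> 0 \<longrightarrow>
      \<bar>h\<bar> < 1 / Suc n \<longrightarrow> \<bar>h'\<bar> < 1 / Suc n \<longrightarrow> \<bar>Q h x - Q h' x\<bar> \<le> 1 / Suc k)" for x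
  \<comment> \<open>The increments now range over the countable type \<open>rat\<close>, so the
    predicate is measurable as soon as each single quotient is.\<close>
  have C_eq: "C = (\<lambda>x. \<forall>k::nat. \<exists>n::nat. \<forall>r::rat. of_rat r \<noteq> (0::real) \<longrightarrow> (\<forall>r'::rat. of_rat r' \<noteq> (0::real) \<longrightarrow>
      \<bar>of_rat r\<bar> < 1 / real (Suc n) \<longrightarrow> \<bar>of_rat r'\<bar> < 1 / real (Suc n) \<longrightarrow>
      \<bar>Q (of_rat r) x - Q (of_rat r') x\<bar> \<le> 1 / Suc k))"
    unfolding C_def Rats_def by (simp only: ball_simps)
  have C_m[measurable]: "Measurable.pred borel C"
    unfolding C_eq by measurable
  define L where "L x = lim (\<lambda>n. Q (1 / Suc n) x)" for x
  have L_m[measurable]: "L \<in> borel_measurable borel"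
    unfolding L_def by measurable
  \<comment> \<open>Where the limit does not exist, \<^const>\<open>deriv\<close> is an unspecified constant.\<close>
  have main: "indicator W x * deriv (\<lambda>s. g (x + s *\<^sub>R e)) 0
     = indicator W x * (if C x then L x else (SOME D. False))" for x
  proof (cases "x \<in> W")
    case True
    have lin: "isCont (\<lambda>s. x + s *\<^sub>R e) s" for s :: real by (intro continuous_intros)
    have "open ((\<lambda>s. x + s *\<^sub>R e) -` W)"
      using W by (intro open_vimage) (auto intro!: continuous_intros)
    moreover have "0 \<in> (\<lambda>s::real. x + s *\<^sub>R e) -` W" using True by simp
    ultimately obtain d where d: "d > 0" "ball 0 d \<subseteq> (\<lambda>s::real. x + s *\<^sub>R e) -` W"
      using open_contains_ball by blast
    then have dW: "x + s *\<^sub>R e \<in> W" if "\<bar>s\<bar> < d" for s using that by (auto simp: subset_iff)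
    have eq: "gt (x + s *\<^sub>R e) = g (x + s *\<^sub>R e)" if "\<bar>s\<bar> < d" for s
      using dW[OF that] by (simp add: gt_def)
    have contQ: "isCont (\<lambda>h. Q h x) h" if "0 < \<bar>h\<bar>" "\<bar>h\<bar> < d" for h
    proof -
      have "isCont (\<lambda>s. g (x + s *\<^sub>R e)) h"
        using isCont_o2[OF lin, of h g] g dW[OF that(2)] continuous_on_eq_continuous_at[OF W, of g] by blast
      moreover have "eventually (\<lambda>s. g (x + s *\<^sub>R e) = gt (x + s *\<^sub>R e)) (nhds h)"
      proof -
        have "eventually (\<lambda>s. s \<in> ball 0 d) (nhds h)"
          using that by (intro eventually_nhds_in_open) auto
        then show ?thesis by eventually_elim (simp add: eq)
      qed
      ultimately have "isCont (\<lambda>s. gt (x + s *\<^sub>R e)) h"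
        using isCont_cong[of "\<lambda>s. g (x + s *\<^sub>R e)" "\<lambda>s. gt (x + s *\<^sub>R e)" h] by simp
      then show ?thesis unfolding Q_def using that by (intro continuous_intros) auto
    qed
    have der: "((\<lambda>s. g (x + s *\<^sub>R e)) has_real_derivative D) (at 0) \<longleftrightarrow> ((\<lambda>h. Q h x) \<longlongrightarrow> D) (at 0)" for D
    proof -
      have "eventually (\<lambda>h. (g (x + (0 + h) *\<^sub>R e) - g (x + 0 *\<^sub>R e)) / h = Q h x) (at 0)"
        unfolding eventually_at
        by (rule exI[of _ d]) (use d eq[of 0] in \<open>auto simp: Q_def eq\<close>)
      then show ?thesis unfolding DERIV_def by (rule tendsto_cong)
    qed
    show ?thesis
    proof (cases "C x")
      case t: True
      then obtain D where D: "((\<lambda>h. Q h x) \<longlongrightarrow> D) (at 0)"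
        using tendsto_at_0_iff_Cauchy_Rats[OF d(1) contQ] unfolding C_def by auto
      have "filterlim (\<lambda>n. 1 / real (Suc n)) (at 0) sequentially"
        unfolding filterlim_at using LIMSEQ_inverse_real_of_nat by (auto simp: inverse_eq_divide)
      from filterlim_compose[OF D this] have "L x = D"
        unfolding L_def by (rule limI)
      moreover have "deriv (\<lambda>s. g (x + s *\<^sub>R e)) 0 = D"
        using der D DERIV_imp_deriv by blast
      ultimately show ?thesis using t by simp
    next
      case f: False
      then have "\<nexists>D. ((\<lambda>h. Q h x) \<longlongrightarrow> D) (at 0)"
        using tendsto_at_0_iff_Cauchy_Rats[OF d(1) contQ] unfolding C_def by blast
      then show ?thesis using f der unfolding deriv_def by simp
    qed
  qed simp
  show ?thesis unfolding main by measurable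
qed

section \<open>Tensor-product splines\<close>

lemma finite_bounded_funs: "finite {e :: 'd::finite \<Rightarrow> nat. \<forall>k. e k < n k}"
proof (rule finite_subset)
  show "{e. \<forall>k. e k < n k} \<subseteq> (\<Pi>\<^sub>E k\<in>UNIV. {..<n k})" by auto
qed (auto intro: finite_PiE)

lemma finite_sp_index: "finite (sp_index Zs q)"
  unfolding sp_index_def by (rule finite_bounded_funs)

text \<open>The cube without the knot hyperplanes, which for open knot vectors is the union of the
  open mesh elements (\<open>sp_generic_iff_mesh\<close>).\<close>

definition sp_generic :: "('d::finite \<Rightarrow> real list) \<Rightarrow> (real^'d) set" where
  "sp_generic Zs = {\<zeta>. \<forall>k. \<zeta> $ k \<in> knot_free (Zs k)}"

definition sp_basis_pderiv :: "('d::finite \<Rightarrow> real list) \<Rightarrow> nat \<Rightarrow> ('d \<Rightarrow> nat) \<Rightarrow> 'd \<Rightarrow> real^'d \<Rightarrow> real" where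
  "sp_basis_pderiv Zs q j k \<zeta> = deriv (bspline (Zs k) q (j k)) (\<zeta> $ k) *
     (\<Prod>l\<in>UNIV - {k}. bspline (Zs l) q (j l) (\<zeta> $ l))"

lemma open_sp_generic: "open (sp_generic Zs)"
proof -
  have "sp_generic Zs = (\<Inter>k\<in>UNIV. (\<lambda>\<zeta>. \<zeta> $ k) -` knot_free (Zs k))"
    by (auto simp: sp_generic_def)
  also have "open \<dots>"
    by (intro open_INT ballI open_vimage open_knot_free continuous_intros) auto
  finally show ?thesis .
qed

lemma sp_generic_subset: "sp_generic Zs \<subseteq> unit_cube"
  by (auto simp: sp_generic_def unit_cube_def knot_free_def)

lemma unit_cube_subset: "unit_cube \<subseteq> cbox 0 (1 :: real^'d::finite)"
  by (auto simp: unit_cube_def mem_box_cart less_eq_real_def)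

lemma sp_basis_continuous:
  assumes "\<And>k. open_knots_maxreg q (Zs k)" "q \<ge> 1" "j \<in> sp_index Zs q"
  shows "continuous_on (cbox 0 1) (sp_basis Zs q j)"
  unfolding sp_basis_def
proof (intro continuous_on_prod)
  fix k
  have "j k + q + 1 < length (Zs k)"
    using assms(3) open_knots_maxregD(2)[OF assms(1), of k] by (auto simp: sp_index_def)
  from bspline_continuous[OF assms(1,2,2) this]
  show "continuous_on (cbox 0 1) (\<lambda>\<zeta>. bspline (Zs k) q (j k) (\<zeta> $ k))"
    by (rule continuous_on_compose2[OF _ linear_continuous_on[OF bounded_linear_vec_nth]])
      (auto simp: mem_box_cart)
qed

lemma bounded_on_cube:
  fixes h :: "real^'d::finite \<Rightarrow> real"
  assumes "continuous_on (cbox 0 1) h"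
  shows "bounded (h ` unit_cube)"
  using compact_imp_bounded[OF compact_continuous_image[OF assms compact_cbox]]
  by (rule bounded_subset[OF _ image_mono[OF unit_cube_subset]])

lemma sp_basis_has_derivative:
  assumes K: "\<And>k. open_knots_maxreg q (Zs k)" and j: "j \<in> sp_index Zs q" and z: "\<zeta> \<in> sp_generic Zs"
  shows "(sp_basis Zs q j has_derivative (\<lambda>h. \<Sum>k\<in>UNIV. h $ k * sp_basis_pderiv Zs q j k \<zeta>)) (at \<zeta>)"
proof -
  have "((\<lambda>\<zeta>. bspline (Zs k) q (j k) (\<zeta> $ k)) has_derivative
      (\<lambda>h. deriv (bspline (Zs k) q (j k)) (\<zeta> $ k) * h $ k)) (at \<zeta>)" for k
  proof -
    have "(bspline (Zs k) q (j k) has_derivative (*) (deriv (bspline (Zs k) q (j k)) (\<zeta> $ k))) (at (\<zeta> $ k))"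
      using bspline_deriv_knot_free(1)[OF K, of "j k" k "\<zeta> $ k"] j z
      by (auto simp: sp_index_def sp_generic_def has_field_derivative_def)
    then show ?thesis
      by (rule has_derivative_compose[OF bounded_linear_imp_has_derivative[OF bounded_linear_vec_nth]])
  qed
  from has_derivative_prod[of UNIV, OF this]
  show ?thesis
    unfolding sp_basis_def sp_basis_pderiv_def by (simp add: ac_simps)
qed

lemma sp_basis_pderiv_continuous:
  assumes K: "\<And>k. open_knots_maxreg q (Zs k)" and q: "q \<ge> 1" and j: "j \<in> sp_index Zs q"
  shows "continuous_on (sp_generic Zs) (sp_basis_pderiv Zs q j k)"
  unfolding sp_basis_pderiv_def
proof (intro continuous_on_mult continuous_on_prod)
  have "continuous_on (knot_free (Zs k)) (deriv (bspline (Zs k) q (j k)))"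
    using bspline_deriv_knot_free(2)[OF K, of "j k" k] j
    by (auto simp: sp_index_def intro!: continuous_at_imp_continuous_on)
  then show "continuous_on (sp_generic Zs) (\<lambda>\<zeta>. deriv (bspline (Zs k) q (j k)) (\<zeta> $ k))"
    by (rule continuous_on_compose2[OF _ linear_continuous_on[OF bounded_linear_vec_nth]])
      (auto simp: sp_generic_def)
next
  fix l
  have "j l + q + 1 < length (Zs l)"
    using j open_knots_maxregD(2)[OF K, of l] by (auto simp: sp_index_def)
  from bspline_continuous[OF K q q this]
  show "continuous_on (sp_generic Zs) (\<lambda>\<zeta>. bspline (Zs l) q (j l) (\<zeta> $ l))"
    by (rule continuous_on_compose2[OF _ linear_continuous_on[OF bounded_linear_vec_nth]])
      (auto simp: sp_generic_def knot_free_def less_eq_real_def)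
qed

lemma bspline_bounded:
  assumes "open_knots_maxreg q Z" "q \<ge> 1" "i < nbasis Z q"
  shows "\<exists>K. \<forall>x\<in>{0..1}. \<bar>bspline Z q i x\<bar> \<le> K"
proof -
  have "i + q + 1 < length Z" using assms open_knots_maxregD(2)[OF assms(1)] by auto
  from compact_imp_bounded[OF compact_continuous_image[OF bspline_continuous[OF assms(1,2,2) this] compact_Icc]]
  show ?thesis unfolding bounded_iff by auto
qed

lemma sp_basis_pderiv_bounded:
  assumes K: "\<And>k. open_knots_maxreg q (Zs k)" and q: "q \<ge> 1" and j: "j \<in> sp_index Zs q"
  shows "\<exists>B. \<forall>\<zeta>\<in>sp_generic Zs. \<bar>sp_basis_pderiv Zs q j k \<zeta>\<bar> \<le> B"
proof -
  have jk: "j l < nbasis (Zs l) q" for l using j by (auto simp: sp_index_def)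
  obtain A where A: "\<And>x. x \<in> knot_free (Zs k) \<Longrightarrow> \<bar>deriv (bspline (Zs k) q (j k)) x\<bar> \<le> A"
    using bspline_deriv_bounded[OF K jk, of k] unfolding bounded_iff by auto
  have "\<forall>l. \<exists>K. \<forall>x\<in>{0..1}. \<bar>bspline (Zs l) q (j l) x\<bar> \<le> K"
    using bspline_bounded[OF K q jk] by blast
  then obtain B where B: "\<And>l x. x \<in> {0..1} \<Longrightarrow> \<bar>bspline (Zs l) q (j l) x\<bar> \<le> B l"
    by metis
  have "\<bar>sp_basis_pderiv Zs q j k \<zeta>\<bar> \<le> A * (\<Prod>l\<in>UNIV - {k}. B l)" if z: "\<zeta> \<in> sp_generic Zs" for \<zeta>
  proof -
    have z1: "\<zeta> $ l \<in> knot_free (Zs l)" "\<zeta> $ l \<in> {0..1}" for l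
      using z by (auto simp: sp_generic_def knot_free_def less_eq_real_def)
    show ?thesis
      unfolding sp_basis_pderiv_def abs_mult abs_prod
      using A[OF z1(1)] B[OF z1(2)] abs_ge_zero order_trans
      by (intro mult_mono prod_mono prod_nonneg) (auto intro: order_trans[OF abs_ge_zero])
  qed
  then show ?thesis by blast
qed

text \<open>The boxes are half-open, so they also contain points on knot hyperplanes, where the
  spline itself may fail to be differentiable. Replacing it there by a polynomial that is
  differentiable everywhere is what shows that F maps the hyperplanes to null sets.\<close>

lemma spline_piece_differentiable:
  assumes K: "\<And>k. open_knots_maxreg q (Zs k)" and e: "\<And>k. e k + 1 < length (Zs k)"
    and s: "s \<in> spatial_splines Zs q"
  shows "\<exists>p. (\<forall>\<zeta>. p differentiable (at \<zeta>)) \<and>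
     (\<forall>\<zeta>. (\<forall>k. \<zeta> $ k \<in> {Zs k ! e k ..< Zs k ! (e k + 1)}) \<longrightarrow> s \<zeta> = p \<zeta>)"
proof -
  obtain c where c: "s = (\<lambda>\<zeta>. \<Sum>j\<in>sp_index Zs q. c j * sp_basis Zs q j \<zeta>)"
    using s by (auto simp: spatial_splines_def)
  have "\<exists>P::real poly. \<forall>x\<in>{Zs k ! e k ..< Zs k ! (e k + 1)}. bspline (Zs k) q (j k) x = poly P x"
    if "j \<in> sp_index Zs q" for j k
    using that open_knots_maxregD(2)[OF K, of k]
    by (intro bspline_eq_poly_on_span[OF open_knots_maxregD(1)[OF K] e]) (auto simp: sp_index_def)
  then obtain P where P: "\<And>j k x. j \<in> sp_index Zs q \<Longrightarrow> x \<in> {Zs k ! e k ..< Zs k ! (e k + 1)} \<Longrightarrow>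
      bspline (Zs k) q (j k) x = poly (P j k) x"
    by metis
  define p where "p \<zeta> = (\<Sum>j\<in>sp_index Zs q. c j * (\<Prod>k\<in>UNIV. poly (P j k) (\<zeta> $ k)))" for \<zeta>
  have pd: "((\<lambda>\<zeta>. poly (P j k) (\<zeta> $ k)) has_derivative (\<lambda>h. poly (pderiv (P j k)) (\<zeta> $ k) * h $ k)) (at \<zeta>)" for j k \<zeta>
  proof -
    have "(poly (P j k) has_derivative (*) (poly (pderiv (P j k)) (\<zeta> $ k))) (at (\<zeta> $ k))"
      using poly_DERIV by (simp add: has_field_derivative_def)
    then show ?thesis
      by (rule has_derivative_compose[OF bounded_linear_imp_has_derivative[OF bounded_linear_vec_nth]])
  qed
  have "p differentiable (at \<zeta>)" for \<zeta>
    unfolding p_def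
  proof (intro differentiable_sum finite_sp_index ballI differentiable_mult differentiable_const)
    fix j
    show "(\<lambda>\<zeta>. \<Prod>k\<in>UNIV. poly (P j k) (\<zeta> $ k)) differentiable (at \<zeta>)"
      by (rule differentiableI, rule has_derivative_prod, rule pd)
  qed
  moreover have "s \<zeta> = p \<zeta>" if "\<forall>k. \<zeta> $ k \<in> {Zs k ! e k ..< Zs k ! (e k + 1)}" for \<zeta>
    unfolding c p_def sp_basis_def
    by (intro sum.cong refl arg_cong2[where f="(*)"] prod.cong P) (use that in auto)
  ultimately show ?thesis by blast
qed

section \<open>The parametrization and the push-forward of splines\<close>

lemma has_vector_derivative_vecI:
  fixes w :: "real \<Rightarrow> real^'d::finite"
  assumes "\<And>k. ((\<lambda>s. w s $ k) has_real_derivative D $ k) (at x)"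
  shows "(w has_vector_derivative D) (at x)"
  unfolding has_vector_derivative_def
proof (subst has_derivative_componentwise_within, intro ballI)
  fix b :: "real^'d" assume "b \<in> Basis"
  then obtain k where b: "b = axis k 1" by (auto simp: Basis_vec_def)
  show "((\<lambda>s. w s \<bullet> b) has_derivative (\<lambda>s. s *\<^sub>R D \<bullet> b)) (at x)"
    using assms[of k] unfolding b has_field_derivative_def
    by (simp add: inner_axis mult.commute[of _ "D $ k"])
qed

lemma negligible_UN: "finite I \<Longrightarrow> (\<And>i. i \<in> I \<Longrightarrow> negligible (A i)) \<Longrightarrow> negligible (\<Union>i\<in>I. A i)"
  by (intro negligible_Union) auto

locale iga_space =
  fixes \<Omega> :: "(real^'d::finite) set" and T :: real
    and Zs :: "'d \<Rightarrow> real list" and qs :: nat and Zt :: "real list" and qt :: nat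
    and F :: "real^'d \<Rightarrow> real^'d"
  assumes bounded_dom: "bounded \<Omega>" and open_dom: "open \<Omega>" and T_pos: "0 < T"
    and qs: "1 \<le> qs" and qt: "1 \<le> qt"
    and knots_s: "\<And>k. open_knots_maxreg qs (Zs k)" and knots_t: "open_knots_maxreg qt Zt"
    and F_bij: "bij_betw F unit_cube \<Omega>"
    and F_spline: "\<And>i. \<exists>s\<in>spatial_splines Zs qs. \<forall>\<zeta>\<in>unit_cube. F \<zeta> $ i = s \<zeta>"
    and F_inv: "\<And>e i. (\<forall>k. e k + 1 < length (Zs k)) \<Longrightarrow>
       bounded_derivs_all_orders (F ` mesh_element Zs e) (\<lambda>x. the_inv_into unit_cube F x $ i)"
begin

definition Fi :: "real^'d \<Rightarrow> real^'d" where "Fi = the_inv_into unit_cube F"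

definition regular :: "(real^'d) set" where "regular = F ` sp_generic Zs"

lemma F_image: "F ` unit_cube = \<Omega>" and F_inj: "inj_on F unit_cube"
  using F_bij by (auto simp: bij_betw_def)

lemma Fi_F [simp]: "\<zeta> \<in> unit_cube \<Longrightarrow> Fi (F \<zeta>) = \<zeta>"
  unfolding Fi_def by (rule the_inv_into_f_f[OF F_inj])

lemma F_Fi: "x \<in> \<Omega> \<Longrightarrow> F (Fi x) = x"
  unfolding Fi_def using f_the_inv_into_f_bij_betw[OF F_bij] by blast

lemma Fi_cube: "x \<in> \<Omega> \<Longrightarrow> Fi x \<in> unit_cube"
  using F_image by (metis Fi_F imageE)

lemma F_cont: "continuous_on unit_cube F"
proof -
  have "continuous_on unit_cube (\<lambda>\<zeta>. F \<zeta> $ i)" for i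
  proof -
    obtain s where s: "s \<in> spatial_splines Zs qs" "\<forall>\<zeta>\<in>unit_cube. F \<zeta> $ i = s \<zeta>"
      using F_spline by blast
    then obtain c where c: "s = (\<lambda>\<zeta>. \<Sum>j\<in>sp_index Zs qs. c j * sp_basis Zs qs j \<zeta>)"
      by (auto simp: spatial_splines_def)
    have "continuous_on (cbox 0 1) s"
      unfolding c by (intro continuous_on_sum continuous_on_mult continuous_on_const sp_basis_continuous knots_s qs)
    then have "continuous_on unit_cube s"
      using continuous_on_subset unit_cube_subset by blast
    then show ?thesis by (rule continuous_on_eq) (use s in auto)
  qed
  then have "continuous_on unit_cube (\<lambda>\<zeta>. \<chi> i. F \<zeta> $ i)"
    by (rule continuous_on_vec_lambda)
  then show ?thesis by simp
qed

text \<open>Invariance of domain. It yields continuity of \<open>Fi\<close> on all of \<Omega>,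
  across element interfaces too, where the derivative bounds on the inverse give no
  information.\<close>

lemma open_image_F: "open S \<Longrightarrow> S \<subseteq> unit_cube \<Longrightarrow> open (F ` S)"
  using invariance_of_domain_gen[of S F] continuous_on_subset[OF F_cont] inj_on_subset[OF F_inj] by auto

lemma open_unit_cube: "open (unit_cube :: (real^'d) set)"
proof -
  have "unit_cube = (box 0 1 :: (real^'d) set)"
    by (auto simp: unit_cube_def mem_box_cart)
  then show ?thesis by (metis open_box)
qed

lemma open_regular: "open regular" and regular_subset: "regular \<subseteq> \<Omega>"
  unfolding regular_def using open_image_F[OF open_sp_generic sp_generic_subset] sp_generic_subset F_image by auto

lemma regular_Fi: "x \<in> regular \<Longrightarrow> Fi x \<in> sp_generic Zs"
  unfolding regular_def using subsetD[OF sp_generic_subset] by (metis Fi_F imageE)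

lemma Fi_cont: "continuous_on \<Omega> Fi"
  unfolding continuous_on_open_vimage[OF open_dom]
proof (intro allI impI)
  fix B :: "(real^'d) set" assume "open B"
  have "Fi -` B \<inter> \<Omega> = F ` (B \<inter> unit_cube)"
    using F_Fi Fi_cube F_image by (auto simp: image_iff)
  then show "open (Fi -` B \<inter> \<Omega>)"
    using open_image_F[of "B \<inter> unit_cube"] open_unit_cube \<open>open B\<close> by auto
qed

section \<open>The exceptional null set and the Jacobian of the inverse\<close>

lemma sp_generic_iff_mesh:
  "\<zeta> \<in> sp_generic Zs \<longleftrightarrow> (\<exists>e. (\<forall>k. e k + 1 < length (Zs k)) \<and> \<zeta> \<in> mesh_element Zs e)"
proof
  assume "\<zeta> \<in> sp_generic Zs"
  then have "\<forall>k. \<exists>l. l + 1 < length (Zs k) \<and> Zs k ! l < \<zeta> $ k \<and> \<zeta> $ k < Zs k ! (l + 1)"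
    using knot_free_iff_span[OF knots_s] by (auto simp: sp_generic_def)
  then obtain e where "\<forall>k. e k + 1 < length (Zs k) \<and> Zs k ! e k < \<zeta> $ k \<and> \<zeta> $ k < Zs k ! (e k + 1)"
    by metis
  then show "\<exists>e. (\<forall>k. e k + 1 < length (Zs k)) \<and> \<zeta> \<in> mesh_element Zs e"
    by (auto simp: mesh_element_def)
next
  assume "\<exists>e. (\<forall>k. e k + 1 < length (Zs k)) \<and> \<zeta> \<in> mesh_element Zs e"
  then show "\<zeta> \<in> sp_generic Zs"
    unfolding sp_generic_def mesh_element_def using knot_free_iff_span[OF knots_s] by auto
qed

text \<open>Differentiable maps send null sets to null sets, but F need not be differentiable on the
  knot hyperplanes. The hyperplanes are therefore cut into finitely many half-open boxes, on each of
  which F agrees with a differentiable map \<open>P\<close>.\<close>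

lemma negligible_exceptional: "negligible (\<Omega> - regular)"
proof -
  let ?I = "{e. \<forall>k. e k < length (Zs k) - 1}"
  let ?H = "\<lambda>e. {\<zeta>. \<forall>k. \<zeta> $ k \<in> {Zs k ! e k ..< Zs k ! (e k + 1)}}"
  define B where "B = unit_cube - sp_generic Zs"
  have negB: "negligible B"
  proof -
    have "negligible {\<zeta>::real^'d. \<zeta> $ k = r}" for k r
      using negligible_standard_hyperplane[of "axis k (1::real)" r] by (simp add: inner_axis)
    then have "negligible (\<Union>k\<in>UNIV. \<Union>r\<in>set (Zs k). {\<zeta>::real^'d. \<zeta> $ k = r})"
      by (intro negligible_UN finite_set finite)
    then show ?thesis
      by (rule negligible_subset) (auto simp: B_def sp_generic_def unit_cube_def knot_free_def)
  qed
  have "negligible (F ` (B \<inter> ?H e))" if e: "e \<in> ?I" for e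
  proof -
    have e': "\<And>k. e k + 1 < length (Zs k)" using e by (auto simp: less_diff_conv)
    have "\<exists>p. (\<forall>\<zeta>. p differentiable (at \<zeta>)) \<and> (\<forall>\<zeta>\<in>B \<inter> ?H e. F \<zeta> $ i = p \<zeta>)" for i
    proof -
      obtain s where s: "s \<in> spatial_splines Zs qs" "\<forall>\<zeta>\<in>unit_cube. F \<zeta> $ i = s \<zeta>"
        using F_spline by blast
      show ?thesis using spline_piece_differentiable[OF knots_s e' s(1)] s(2) unfolding B_def by force
    qed
    then have "\<exists>p. \<forall>i. (\<forall>\<zeta>. p i differentiable (at \<zeta>)) \<and> (\<forall>\<zeta>\<in>B \<inter> ?H e. F \<zeta> $ i = p i \<zeta>)"
      by (intro choice allI)
    then obtain p where p: "\<And>i \<zeta>. p i differentiable (at \<zeta>)"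
      "\<And>i \<zeta>. \<zeta> \<in> B \<inter> ?H e \<Longrightarrow> F \<zeta> $ i = p i \<zeta>"
      by blast
    define P where "P \<zeta> = (\<chi> i. p i \<zeta>)" for \<zeta>
    have "P differentiable (at \<zeta> within X)" for \<zeta> X
    proof (subst differentiable_componentwise_within, intro ballI)
      fix b :: "real^'d" assume "b \<in> Basis"
      then obtain k where b: "b = axis k 1" by (auto simp: Basis_vec_def)
      show "(\<lambda>x. P x \<bullet> b) differentiable (at \<zeta> within X)"
        using p(1)[of k \<zeta>] differentiable_at_withinI unfolding b P_def by (auto simp: inner_axis)
    qed
    then have neg: "negligible (P ` (B \<inter> ?H e))"
      by (intro negligible_differentiable_image_negligible negligible_Int negB)
        (auto simp: differentiable_on_def negB)
    have "P \<zeta> = F \<zeta>" if "\<zeta> \<in> B \<inter> ?H e" for \<zeta>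
      using p(2)[OF that] by (simp add: P_def vec_eq_iff)
    then have "P ` (B \<inter> ?H e) = F ` (B \<inter> ?H e)" by (rule image_cong[OF refl])
    then show ?thesis using neg by simp
  qed
  then have "negligible (\<Union>e\<in>?I. F ` (B \<inter> ?H e))"
    by (intro negligible_UN finite_bounded_funs)
  moreover have "\<Omega> - regular \<subseteq> (\<Union>e\<in>?I. F ` (B \<inter> ?H e))"
  proof
    fix x assume x: "x \<in> \<Omega> - regular"
    then have z: "Fi x \<in> B" "F (Fi x) = x"
      unfolding B_def regular_def using F_Fi[of x] Fi_cube[of x] by force+
    have "\<exists>l. l + 1 < length (Zs k) \<and> Zs k ! l \<le> Fi x $ k \<and> Fi x $ k < Zs k ! (l+1)" for k
      using z(1) by (intro ex_span[OF knots_s]) (auto simp: B_def unit_cube_def less_eq_real_def)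
    then obtain e where e: "\<And>k. e k + 1 < length (Zs k) \<and> Zs k ! e k \<le> Fi x $ k \<and> Fi x $ k < Zs k ! (e k+1)"
      by metis
    then have "e \<in> ?I" "Fi x \<in> ?H e" by (auto simp: less_diff_conv)
    then show "x \<in> (\<Union>e\<in>?I. F ` (B \<inter> ?H e))" using z(1) z(2)[symmetric] by blast
  qed
  ultimately show ?thesis by (rule negligible_subset)
qed

text \<open>Column i of the Jacobian matrix of \<open>Fi\<close>. It is assembled from derivatives
  along coordinate lines, the form in which the hypothesis on the inverse supplies them.\<close>

definition Jac :: "real^'d \<Rightarrow> 'd \<Rightarrow> real^'d" where
  "Jac x i = (\<chi> k. deriv (\<lambda>s. Fi (x + s *\<^sub>R axis i 1) $ k) 0)"

lemma Fi_line_deriv: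
  assumes "x \<in> regular"
  shows "((\<lambda>s. Fi (x + s *\<^sub>R axis i 1)) has_vector_derivative Jac x i) (at 0)"
proof (rule has_vector_derivative_vecI)
  fix k
  obtain e where e: "\<forall>k. e k + 1 < length (Zs k)" "x \<in> F ` mesh_element Zs e"
    using assms sp_generic_iff_mesh unfolding regular_def by blast
  \<comment> \<open>The empty list of directions selects the differentiability statement for the
    inverse itself rather than for one of its derivatives.\<close>
  have "\<exists>D. ((\<lambda>s. iter_pderiv [] (\<lambda>x. the_inv_into unit_cube F x $ k) (x + s *\<^sub>R axis i 1)) has_real_derivative D) (at 0)"
    using F_inv[OF e(1), of k] e(2) unfolding bounded_derivs_all_orders_def by blast
  then show "((\<lambda>s. Fi (x + s *\<^sub>R axis i 1) $ k) has_real_derivative Jac x i $ k) (at 0)"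
    unfolding Jac_def Fi_def using DERIV_imp_deriv by fastforce
qed

text \<open>The first-order bounds on the inverse, made uniform over the finitely many mesh
  elements.\<close>

lemma Jac_bounded: "\<exists>K. \<forall>x\<in>regular. \<forall>i. norm (Jac x i) \<le> K"
proof -
  let ?I = "{e. \<forall>k. e k < length (Zs k) - 1}"
  have "bounded ((\<lambda>x. Jac x i $ k) ` regular)" for i k
  proof -
    have "bounded (\<Union>e\<in>?I. iter_pderiv [i] (\<lambda>x. the_inv_into unit_cube F x $ k) ` F ` mesh_element Zs e)"
      using F_inv unfolding bounded_derivs_all_orders_def
      by (intro bounded_UN finite_bounded_funs ballI) (auto simp: less_diff_conv simp del: iter_pderiv.simps)
    then show ?thesis
    proof (rule bounded_subset, intro image_subsetI)
      fix x assume "x \<in> regular"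
      then obtain e where e: "\<forall>k. e k + 1 < length (Zs k)" "x \<in> F ` mesh_element Zs e"
        using sp_generic_iff_mesh unfolding regular_def by blast
      then show "Jac x i $ k \<in> (\<Union>e\<in>?I. iter_pderiv [i] (\<lambda>x. the_inv_into unit_cube F x $ k) ` F ` mesh_element Zs e)"
        by (intro UN_I[of e]) (auto simp: Jac_def Fi_def less_diff_conv)
    qed
  qed
  then have "\<forall>i k. \<exists>K. \<forall>x\<in>regular. \<bar>Jac x i $ k\<bar> \<le> K"
    unfolding bounded_iff by auto
  then obtain K where K: "\<And>i k x. x \<in> regular \<Longrightarrow> \<bar>Jac x i $ k\<bar> \<le> K i k"
    by metis
  have "norm (Jac x i) \<le> (\<Sum>i\<in>UNIV. \<Sum>k\<in>UNIV. \<bar>K i k\<bar>)" if "x \<in> regular" for x i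
  proof -
    have "norm (Jac x i) \<le> (\<Sum>k\<in>UNIV. \<bar>Jac x i $ k\<bar>)" by (rule norm_le_l1_cart)
    also have "\<dots> \<le> (\<Sum>k\<in>UNIV. \<bar>K i k\<bar>)" using K[OF that] by (intro sum_mono) (metis abs_ge_self order_trans)
    also have "\<dots> \<le> (\<Sum>i\<in>UNIV. \<Sum>k\<in>UNIV. \<bar>K i k\<bar>)"
      by (rule member_le_sum[of i UNIV "\<lambda>i. \<Sum>k\<in>UNIV. \<bar>K i k\<bar>"]) (auto intro: sum_nonneg)
    finally show ?thesis .
  qed
  then show ?thesis by blast
qed

lemma spline_has_derivative:
  assumes "\<zeta> \<in> sp_generic Zs"
  shows "((\<lambda>\<zeta>. \<Sum>j\<in>sp_index Zs qs. c j * sp_basis Zs qs j \<zeta>) has_derivative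
    (\<lambda>h. h \<bullet> (\<chi> k. \<Sum>j\<in>sp_index Zs qs. c j * sp_basis_pderiv Zs qs j k \<zeta>))) (at \<zeta>)"
proof -
  have "((\<lambda>\<zeta>. \<Sum>j\<in>sp_index Zs qs. c j * sp_basis Zs qs j \<zeta>) has_derivative
    (\<lambda>h. \<Sum>j\<in>sp_index Zs qs. c j * (\<Sum>k\<in>UNIV. h $ k * sp_basis_pderiv Zs qs j k \<zeta>))) (at \<zeta>)"
    by (intro has_derivative_sum has_derivative_mult_right sp_basis_has_derivative knots_s assms)
  also have "(\<lambda>h. \<Sum>j\<in>sp_index Zs qs. c j * (\<Sum>k\<in>UNIV. h $ k * sp_basis_pderiv Zs qs j k \<zeta>))
     = (\<lambda>h. h \<bullet> (\<chi> k. \<Sum>j\<in>sp_index Zs qs. c j * sp_basis_pderiv Zs qs j k \<zeta>))"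
    by (subst sum_distrib_left, subst sum.swap) (simp add: inner_vec_def sum_distrib_left ac_simps)
  finally show ?thesis .
qed

lemma line_in_regular:
  assumes "x \<in> regular"
  shows "eventually (\<lambda>s. x + s *\<^sub>R axis i 1 \<in> regular) (nhds (0::real))"
proof -
  have "open ((\<lambda>s::real. x + s *\<^sub>R axis i 1) -` regular)"
    by (intro open_vimage open_regular) (auto intro!: continuous_intros)
  then show ?thesis
    using assms eventually_nhds_in_open[of "(\<lambda>s::real. x + s *\<^sub>R axis i 1) -` regular" 0] by simp
qed

text \<open>Each component s_r of F is a spline with s_r (Fi y) = y_r near x. Differentiating along
  axis i gives Jac x i . grad s_r = 1 if r = i and 0 otherwise, so the columns have a dual family.
  Being as many as the dimension, they span the space, and a vector orthogonal to all of them is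
  0.\<close>

lemma Jac_total:
  assumes x: "x \<in> regular" and P: "\<And>i. Jac x i \<bullet> P = 0"
  shows "P = 0"
proof -
  have "\<exists>g. \<forall>i. Jac x i \<bullet> g = (if r = i then 1 else 0)" for r
  proof -
    obtain s where s: "s \<in> spatial_splines Zs qs" "\<forall>\<zeta>\<in>unit_cube. F \<zeta> $ r = s \<zeta>"
      using F_spline by blast
    then obtain c where c: "s = (\<lambda>\<zeta>. \<Sum>j\<in>sp_index Zs qs. c j * sp_basis Zs qs j \<zeta>)"
      by (auto simp: spatial_splines_def)
    obtain g where g: "(s has_derivative (\<lambda>h. h \<bullet> g)) (at (Fi x))"
      using spline_has_derivative[OF regular_Fi[OF x], of c] unfolding c by blast
    have "Jac x i \<bullet> g = (if r = i then 1 else 0)" for i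
    proof -
      have "((\<lambda>t. s (Fi (x + t *\<^sub>R axis i 1))) has_derivative (\<lambda>t. (t *\<^sub>R Jac x i) \<bullet> g)) (at 0)"
        by (rule has_derivative_compose[OF Fi_line_deriv[OF x, of i, unfolded has_vector_derivative_def]])
          (use g in simp)
      then have 1: "((\<lambda>t. s (Fi (x + t *\<^sub>R axis i 1))) has_real_derivative (Jac x i \<bullet> g)) (at 0)"
        by (simp add: has_field_derivative_def mult.commute[of _ "Jac x i \<bullet> g"])
      have ev: "eventually (\<lambda>t. s (Fi (x + t *\<^sub>R axis i 1)) = x $ r + t * (if r = i then 1 else 0)) (nhds 0)"
        using line_in_regular[OF x, of i]
      proof eventually_elim
        case (elim t)
        then have "x + t *\<^sub>R axis i 1 \<in> \<Omega>" using regular_subset by auto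
        then have "s (Fi (x + t *\<^sub>R axis i 1)) = (x + t *\<^sub>R axis i 1) $ r"
          using s(2) Fi_cube F_Fi by metis
        then show ?case by (simp add: axis_def)
      qed
      have "((\<lambda>t. x $ r + t * (if r = i then 1 else 0)) has_real_derivative (if r = i then 1 else 0)) (at 0)"
        by (auto intro!: derivative_eq_intros)
      then have "((\<lambda>t. s (Fi (x + t *\<^sub>R axis i 1))) has_real_derivative (if r = i then 1 else 0)) (at 0)"
        using DERIV_cong_ev[OF refl ev refl] by blast
      then show ?thesis using 1 DERIV_unique by blast
    qed
    then show ?thesis by blast
  qed
  then obtain g where g: "\<And>r i. Jac x i \<bullet> g r = (if r = i then 1 else 0)" by metis
  \<comment> \<open>Pairing \<open>L v\<close> with \<open>g r\<close> recovers v_r, so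
    \<open>L\<close> is injective, hence onto; \<open>P\<close> is then a combination of columns to
    which it is orthogonal.\<close>
  define L where "L v = (\<Sum>i\<in>UNIV. v $ i *\<^sub>R Jac x i)" for v :: "real^'d"
  have lin: "linear L"
    unfolding L_def by (intro linearI) (auto simp: sum.distrib scaleR_left_distrib scaleR_sum_right)
  have Lg: "L v \<bullet> g r = v $ r" for v r
    unfolding L_def by (simp add: inner_sum_left g if_distrib cong: if_cong)
  have "inj L"
    by (rule injI) (metis Lg vec_eq_iff)
  then have "surj L" using linear_injective_imp_surjective[OF lin] by simp
  then obtain v where v: "P = L v" by (metis surjD)
  have "P \<bullet> P = (\<Sum>i\<in>UNIV. v $ i * (Jac x i \<bullet> P))"
    by (subst (1) v) (simp add: L_def inner_sum_left)
  then show ?thesis using P by simp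
qed

end

lemma bounded_on_linear_combination:
  fixes f :: "'i \<Rightarrow> 'z \<Rightarrow> real"
  assumes "finite I" "\<And>i. i \<in> I \<Longrightarrow> \<exists>K. \<forall>z\<in>S. \<bar>f i z\<bar> \<le> K"
  shows "\<exists>K. \<forall>z\<in>S. \<bar>\<Sum>i\<in>I. c i * f i z\<bar> \<le> K"
proof -
  obtain K where K: "\<And>i z. i \<in> I \<Longrightarrow> z \<in> S \<Longrightarrow> \<bar>f i z\<bar> \<le> K i"
    using assms(2) by metis
  have "\<bar>\<Sum>i\<in>I. c i * f i z\<bar> \<le> (\<Sum>i\<in>I. \<bar>c i\<bar> * K i)" if "z \<in> S" for z
    by (rule order_trans[OF sum_abs]) (auto simp: abs_mult intro!: sum_mono mult_left_mono K that)
  then show ?thesis by blast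
qed

lemma bounded_on_mult:
  fixes f g :: "'z \<Rightarrow> real"
  assumes "\<exists>K. \<forall>z\<in>S. \<bar>f z\<bar> \<le> K" "\<exists>K. \<forall>z\<in>S. \<bar>g z\<bar> \<le> K"
  shows "\<exists>K. \<forall>z\<in>S. \<bar>f z * g z\<bar> \<le> K"
proof -
  obtain A B where "\<And>z. z \<in> S \<Longrightarrow> \<bar>f z\<bar> \<le> A" "\<And>z. z \<in> S \<Longrightarrow> \<bar>g z\<bar> \<le> B" using assms by blast
  then have "\<bar>f z * g z\<bar> \<le> A * B" if "z \<in> S" for z
    using that unfolding abs_mult by (intro mult_mono) (auto intro: order_trans[OF abs_ge_zero])
  then show ?thesis by blast
qed

section \<open>Space-time splines in coefficient form and their push-forward\<close>

context iga_space
begin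

definition st_index :: "(('d \<Rightarrow> nat) \<times> nat) set" where
  "st_index = sp_index Zs qs \<times> {..<nbasis Zt qt}"

text \<open>Members of V_h are represented by coefficient families c. Combinations, spatial means
  and the formal derivatives \<open>ref_grad\<close> and \<open>ref_dt\<close> are then explicit
  sums linear in c, whereas classical derivatives of the functions are linear only where they
  exist.\<close>

definition ref :: "(('d \<Rightarrow> nat) \<times> nat \<Rightarrow> real) \<Rightarrow> real^'d \<Rightarrow> real \<Rightarrow> real" where
  "ref c \<zeta> \<tau> = (\<Sum>i\<in>st_index. c i * (sp_basis Zs qs (fst i) \<zeta> * bspline Zt qt (snd i) \<tau>))"

definition ref_grad :: "(('d \<Rightarrow> nat) \<times> nat \<Rightarrow> real) \<Rightarrow> real^'d \<Rightarrow> real \<Rightarrow> real^'d" where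
  "ref_grad c \<zeta> \<tau> = (\<chi> k. \<Sum>i\<in>st_index. c i * (sp_basis_pderiv Zs qs (fst i) k \<zeta> * bspline Zt qt (snd i) \<tau>))"

definition ref_dt :: "(('d \<Rightarrow> nat) \<times> nat \<Rightarrow> real) \<Rightarrow> real^'d \<Rightarrow> real \<Rightarrow> real" where
  "ref_dt c \<zeta> \<tau> = (\<Sum>i\<in>st_index. c i * (sp_basis Zs qs (fst i) \<zeta> * deriv (bspline Zt qt (snd i)) \<tau>))"

definition phys :: "(('d \<Rightarrow> nat) \<times> nat \<Rightarrow> real) \<Rightarrow> (real^'d) \<times> real \<Rightarrow> real" where
  "phys c z = ref c (Fi (fst z)) (snd z / T)"

definition adm :: "(('d \<Rightarrow> nat) \<times> nat \<Rightarrow> real) set" where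
  "adm = {c. (\<forall>\<zeta>\<in>unit_cube_boundary. \<forall>\<tau>. 0 < \<tau> \<and> \<tau> < 1 \<longrightarrow> ref c \<zeta> \<tau> = 0) \<and> (\<forall>\<zeta>\<in>unit_cube. ref c \<zeta> 0 = 0)}"

lemma finite_st_index: "finite st_index"
  unfolding st_index_def using finite_sp_index by auto

lemma st_splines_eq: "st_splines Zs qs Zt qt = range ref"
  unfolding st_splines_def ref_def st_index_def by (auto simp: fun_eq_iff case_prod_beta mult.assoc image_iff)

lemma Vh_eq: "Vh Zs qs Zt qt F T = phys ` adm"
proof -
  have "(\<lambda>(x, t). ref c (the_inv_into unit_cube F x) (t / T)) = phys c" for c
    by (auto simp: phys_def Fi_def)
  then show ?thesis
    unfolding Vh_def st_splines_eq adm_def by (auto simp: image_iff) metis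
qed

definition regular_times :: "real set" where "regular_times = {t. t / T \<in> knot_free Zt}"

lemma open_regular_times: "open regular_times"
proof -
  have "regular_times = (\<lambda>t. t / T) -` knot_free Zt" by (auto simp: regular_times_def)
  also have "open \<dots>" using T_pos by (intro open_vimage open_knot_free continuous_intros) auto
  finally show ?thesis .
qed

lemma regular_times_subset: "regular_times \<subseteq> {0<..<T}"
  using T_pos by (auto simp: regular_times_def knot_free_def field_simps)

lemma regular_times_cofinite: "finite ({0<..<T} - regular_times)"
proof (rule finite_subset)
  show "{0<..<T} - regular_times \<subseteq> (\<lambda>r. T * r) ` set Zt"
    using T_pos by (force simp: regular_times_def knot_free_def)
qed simp

text \<open>The points at which the derivatives of all members of V_h exist with known formulas. The
  product form allows space and time to be varied independently.\<close>

definition S :: "((real^'d) \<times> real) set" where "S = regular \<times> regular_times"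

definition W :: "((real^'d) \<times> real) set" where "W = \<Omega> \<times> {0<..<T}"

lemma open_S: "open S" and open_W: "open W" and S_W: "S \<subseteq> W"
  unfolding S_def W_def using open_regular open_regular_times open_dom regular_subset regular_times_subset
  by (auto intro: open_Times)

lemma sp_index_st: "i \<in> st_index \<Longrightarrow> fst i \<in> sp_index Zs qs" "i \<in> st_index \<Longrightarrow> snd i < nbasis Zt qt"
  by (auto simp: st_index_def)

lemma time_basis_cont:
  assumes "i \<in> st_index"
  shows "continuous_on {0..1} (bspline Zt qt (snd i))"
  using bspline_continuous[OF knots_t qt qt, of "snd i"] sp_index_st(2)[OF assms] open_knots_maxregD(2)[OF knots_t]
  by simp

lemma ref_time_cont: "continuous_on {0..1} (ref c \<zeta>)"
  unfolding ref_def by (intro continuous_on_sum continuous_on_mult continuous_on_const time_basis_cont)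

lemma ref_space_cont: "continuous_on (cbox 0 1) (\<lambda>\<zeta>. ref c \<zeta> \<tau>)"
  unfolding ref_def
  by (intro continuous_on_sum continuous_on_mult continuous_on_const sp_basis_continuous knots_s qs sp_index_st)

lemma sp_basis_Fi_cont:
  assumes "j \<in> sp_index Zs qs"
  shows "continuous_on \<Omega> (\<lambda>x. sp_basis Zs qs j (Fi x))"
  by (rule continuous_on_compose2[OF sp_basis_continuous[OF knots_s qs assms] Fi_cont])
    (use Fi_cube unit_cube_subset in blast)

lemma phys_cont: "continuous_on W (phys c)"
  unfolding phys_def ref_def
proof (intro continuous_on_sum continuous_on_mult continuous_on_const)
  fix i assume i: "i \<in> st_index"
  show "continuous_on W (\<lambda>z. sp_basis Zs qs (fst i) (Fi (fst z)))"
    by (rule continuous_on_compose2[OF sp_basis_Fi_cont[OF sp_index_st(1)[OF i]]])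
      (auto simp: W_def intro!: continuous_on_fst)
  show "continuous_on W (\<lambda>z. bspline Zt qt (snd i) (snd z / T))"
    by (rule continuous_on_compose2[OF time_basis_cont[OF i]])
      (use T_pos in \<open>auto simp: W_def divide_le_eq_1 intro!: continuous_on_snd continuous_on_divide continuous_on_const\<close>)
qed

lemma ref_has_derivative:
  assumes "\<zeta> \<in> sp_generic Zs"
  shows "((\<lambda>\<zeta>. ref c \<zeta> \<tau>) has_derivative (\<lambda>h. h \<bullet> ref_grad c \<zeta> \<tau>)) (at \<zeta>)"
proof -
  have "((\<lambda>\<zeta>. ref c \<zeta> \<tau>) has_derivative (\<lambda>h. \<Sum>i\<in>st_index. c i *
      ((\<Sum>k\<in>UNIV. h $ k * sp_basis_pderiv Zs qs (fst i) k \<zeta>) * bspline Zt qt (snd i) \<tau>))) (at \<zeta>)"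
    unfolding ref_def
    by (intro has_derivative_sum has_derivative_mult_right has_derivative_mult_left sp_basis_has_derivative
        knots_s assms sp_index_st)
  also have "(\<lambda>h. \<Sum>i\<in>st_index. c i *
      ((\<Sum>k\<in>UNIV. h $ k * sp_basis_pderiv Zs qs (fst i) k \<zeta>) * bspline Zt qt (snd i) \<tau>))
    = (\<lambda>h. \<Sum>i\<in>st_index. \<Sum>k\<in>UNIV. c i *
      ((h $ k * sp_basis_pderiv Zs qs (fst i) k \<zeta>) * bspline Zt qt (snd i) \<tau>))"
    by (simp add: sum_distrib_left sum_distrib_right)
  also have "\<dots> = (\<lambda>h. h \<bullet> ref_grad c \<zeta> \<tau>)"
    by (subst sum.swap) (simp add: ref_grad_def inner_vec_def sum_distrib_left ac_simps)
  finally show ?thesis .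
qed

text \<open>The outer spline has a total derivative at \<open>Fi x\<close>, so differentiability of
  \<open>Fi\<close> along the single line is enough for the chain rule.\<close>

lemma phys_line_deriv:
  assumes x: "x \<in> regular"
  shows "((\<lambda>s. phys c (x + s *\<^sub>R axis i 1, t)) has_real_derivative Jac x i \<bullet> ref_grad c (Fi x) (t / T)) (at 0)"
proof -
  have "((\<lambda>s. ref c (Fi (x + s *\<^sub>R axis i 1)) (t / T)) has_derivative
     (\<lambda>s. (s *\<^sub>R Jac x i) \<bullet> ref_grad c (Fi x) (t / T))) (at 0)"
    by (rule has_derivative_compose[OF Fi_line_deriv[OF x, of i, unfolded has_vector_derivative_def]])
      (use ref_has_derivative[OF regular_Fi[OF x]] in simp)
  then show ?thesis
    by (simp add: phys_def has_field_derivative_def mult.commute[of _ "Jac x i \<bullet> ref_grad c (Fi x) (t / T)"])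
qed

lemma space_grad_phys:
  assumes "z \<in> S"
  shows "space_grad (phys c) z = (\<chi> i. Jac (fst z) i \<bullet> ref_grad c (Fi (fst z)) (snd z / T))"
  using assms DERIV_imp_deriv[OF phys_line_deriv] by (auto simp: space_grad_def S_def vec_eq_iff)

lemma phys_time_has_deriv:
  assumes t: "t \<in> regular_times"
  shows "((\<lambda>s. phys c (x, s)) has_real_derivative ref_dt c (Fi x) (t / T) / T) (at t)"
proof -
  have "((\<lambda>s. bspline Zt qt (snd i) (s / T)) has_real_derivative deriv (bspline Zt qt (snd i)) (t / T) * (1 / T)) (at t)"
    if "i \<in> st_index" for i
    by (rule DERIV_chain2[OF bspline_deriv_knot_free(1)[OF knots_t sp_index_st(2)[OF that]]])
      (use t T_pos in \<open>auto simp: regular_times_def intro!: derivative_eq_intros\<close>)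
  then have "((\<lambda>s. phys c (x, s)) has_real_derivative
     (\<Sum>i\<in>st_index. c i * (sp_basis Zs qs (fst i) (Fi x) * (deriv (bspline Zt qt (snd i)) (t / T) * (1 / T))))) (at t)"
    unfolding phys_def ref_def fst_conv snd_conv by (intro DERIV_sum DERIV_cmult)
  then show ?thesis by (simp add: ref_dt_def sum_divide_distrib)
qed

lemma time_deriv_phys:
  assumes "z \<in> S"
  shows "time_deriv (phys c) z = ref_dt c (Fi (fst z)) (snd z / T) / T"
  using assms DERIV_imp_deriv[OF phys_time_has_deriv] by (auto simp: time_deriv_def S_def)

lemma ref_linear: "ref (\<lambda>j. \<Sum>k\<in>A. r k * \<gamma> k j) \<zeta> \<tau> = (\<Sum>k\<in>A. r k * ref (\<gamma> k) \<zeta> \<tau>)"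
  unfolding ref_def sum_distrib_left sum_distrib_right
  by (subst sum.swap) (simp add: mult.assoc)

lemma ref_dt_linear: "ref_dt (\<lambda>j. \<Sum>k\<in>A. r k * \<gamma> k j) \<zeta> \<tau> = (\<Sum>k\<in>A. r k * ref_dt (\<gamma> k) \<zeta> \<tau>)"
  unfolding ref_dt_def sum_distrib_left sum_distrib_right
  by (subst sum.swap) (simp add: mult.assoc)

lemma ref_grad_linear: "ref_grad (\<lambda>j. \<Sum>k\<in>A. r k * \<gamma> k j) \<zeta> \<tau> = (\<Sum>k\<in>A. r k *\<^sub>R ref_grad (\<gamma> k) \<zeta> \<tau>)"
proof -
  have "(\<Sum>i\<in>st_index. (\<Sum>k\<in>A. r k * \<gamma> k i) * (sp_basis_pderiv Zs qs (fst i) l \<zeta> * bspline Zt qt (snd i) \<tau>))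
      = (\<Sum>k\<in>A. r k * (\<Sum>i\<in>st_index. \<gamma> k i * (sp_basis_pderiv Zs qs (fst i) l \<zeta> * bspline Zt qt (snd i) \<tau>)))" for l
    unfolding sum_distrib_left sum_distrib_right
    by (subst sum.swap) (simp add: mult.assoc)
  then show ?thesis by (simp add: ref_grad_def vec_eq_iff)
qed

lemma phys_linear: "phys (\<lambda>j. \<Sum>k\<in>A. r k * \<gamma> k j) z = (\<Sum>k\<in>A. r k * phys (\<gamma> k) z)"
  by (simp add: phys_def ref_linear)

lemma adm_linear: "(\<And>k. k \<in> A \<Longrightarrow> \<gamma> k \<in> adm) \<Longrightarrow> (\<lambda>j. \<Sum>k\<in>A. r k * \<gamma> k j) \<in> adm"
  unfolding adm_def by (auto simp: ref_linear)

lemma time_deriv_linear: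
  "z \<in> S \<Longrightarrow> time_deriv (phys (\<lambda>j. \<Sum>k\<in>A. r k * \<gamma> k j)) z = (\<Sum>k\<in>A. r k * time_deriv (phys (\<gamma> k)) z)"
  by (simp add: time_deriv_phys ref_dt_linear sum_divide_distrib)

lemma space_grad_linear:
  "z \<in> S \<Longrightarrow> space_grad (phys (\<lambda>j. \<Sum>k\<in>A. r k * \<gamma> k j)) z = (\<Sum>k\<in>A. r k *\<^sub>R space_grad (phys (\<gamma> k)) z)"
  by (simp add: space_grad_phys ref_grad_linear inner_sum_right vec_eq_iff)

section \<open>Uniform bounds, and functions with vanishing gradient\<close>

lemma sp_basis_bounded_Fi:
  assumes "j \<in> sp_index Zs qs"
  shows "\<exists>K. \<forall>x\<in>\<Omega>. \<bar>sp_basis Zs qs j (Fi x)\<bar> \<le> K"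
  using bounded_on_cube[OF sp_basis_continuous[OF knots_s qs assms]] Fi_cube
  unfolding bounded_iff by auto

lemma phys_bounded: "\<exists>K. \<forall>z\<in>W. \<bar>phys c z\<bar> \<le> K"
  unfolding phys_def ref_def
proof (intro bounded_on_linear_combination bounded_on_mult finite_st_index)
  fix i assume i: "i \<in> st_index"
  show "\<exists>K. \<forall>z\<in>W. \<bar>sp_basis Zs qs (fst i) (Fi (fst z))\<bar> \<le> K"
    using sp_basis_bounded_Fi[OF sp_index_st(1)[OF i]] by (auto simp: W_def)
  have "snd z / T \<in> {0..1}" if "z \<in> W" for z
    using that T_pos by (auto simp: W_def divide_le_eq_1)
  then show "\<exists>K. \<forall>z\<in>W. \<bar>bspline Zt qt (snd i) (snd z / T)\<bar> \<le> K"
    using bspline_bounded[OF knots_t qt sp_index_st(2)[OF i]] by metis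
qed

lemma S_timeD: "z \<in> S \<Longrightarrow> snd z / T \<in> knot_free Zt" "z \<in> S \<Longrightarrow> snd z / T \<in> {0..1}"
  by (auto simp: S_def regular_times_def knot_free_def less_eq_real_def)

lemma S_spaceD: "z \<in> S \<Longrightarrow> fst z \<in> regular" "z \<in> S \<Longrightarrow> fst z \<in> \<Omega>"
  using regular_subset by (auto simp: S_def)

lemma time_deriv_bounded: "\<exists>K. \<forall>z\<in>S. \<bar>time_deriv (phys c) z\<bar> \<le> K"
proof -
  have "\<exists>K. \<forall>z\<in>S. \<bar>ref_dt c (Fi (fst z)) (snd z / T)\<bar> \<le> K"
    unfolding ref_dt_def
  proof (intro bounded_on_linear_combination bounded_on_mult finite_st_index)
    fix i assume i: "i \<in> st_index"
    show "\<exists>K. \<forall>z\<in>S. \<bar>sp_basis Zs qs (fst i) (Fi (fst z))\<bar> \<le> K"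
      using sp_basis_bounded_Fi[OF sp_index_st(1)[OF i]] S_spaceD by blast
    show "\<exists>K. \<forall>z\<in>S. \<bar>deriv (bspline Zt qt (snd i)) (snd z / T)\<bar> \<le> K"
      using bspline_deriv_bounded[OF knots_t sp_index_st(2)[OF i]] S_timeD
      unfolding bounded_iff by (metis image_eqI real_norm_def)
  qed
  then obtain K where K: "\<And>z. z \<in> S \<Longrightarrow> \<bar>ref_dt c (Fi (fst z)) (snd z / T)\<bar> \<le> K" by blast
  then have "\<bar>time_deriv (phys c) z\<bar> \<le> K / T" if "z \<in> S" for z
    using K[OF that] T_pos by (simp add: time_deriv_phys[OF that] divide_right_mono)
  then show ?thesis by blast
qed

lemma space_grad_bounded: "\<exists>K. \<forall>z\<in>S. norm (space_grad (phys c) z) \<le> K"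
proof -
  have "\<exists>K. \<forall>z\<in>S. \<bar>ref_grad c (Fi (fst z)) (snd z / T) $ k\<bar> \<le> K" for k
    unfolding ref_grad_def vec_lambda_beta
  proof (intro bounded_on_linear_combination bounded_on_mult finite_st_index)
    fix i assume i: "i \<in> st_index"
    show "\<exists>K. \<forall>z\<in>S. \<bar>sp_basis_pderiv Zs qs (fst i) k (Fi (fst z))\<bar> \<le> K"
      using sp_basis_pderiv_bounded[OF knots_s qs sp_index_st(1)[OF i]] S_spaceD(1) regular_Fi by metis
    show "\<exists>K. \<forall>z\<in>S. \<bar>bspline Zt qt (snd i) (snd z / T)\<bar> \<le> K"
      using bspline_bounded[OF knots_t qt sp_index_st(2)[OF i]] S_timeD by metis
  qed
  then obtain A where A: "\<And>k z. z \<in> S \<Longrightarrow> \<bar>ref_grad c (Fi (fst z)) (snd z / T) $ k\<bar> \<le> A k"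
    by metis
  obtain K where K: "\<And>x i. x \<in> regular \<Longrightarrow> norm (Jac x i) \<le> K" using Jac_bounded by blast
  have "norm (space_grad (phys c) z) \<le> (\<Sum>i\<in>(UNIV::'d set). K * (\<Sum>k\<in>UNIV. A k))" if z: "z \<in> S" for z
  proof -
    have "norm (ref_grad c (Fi (fst z)) (snd z / T)) \<le> (\<Sum>k\<in>UNIV. \<bar>ref_grad c (Fi (fst z)) (snd z / T) $ k\<bar>)"
      by (rule norm_le_l1_cart)
    also have "\<dots> \<le> (\<Sum>k\<in>UNIV. A k)" using A[OF z] by (intro sum_mono)
    finally have g: "norm (ref_grad c (Fi (fst z)) (snd z / T)) \<le> (\<Sum>k\<in>UNIV. A k)" .
    have "norm (space_grad (phys c) z) \<le> (\<Sum>i\<in>UNIV. \<bar>space_grad (phys c) z $ i\<bar>)"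
      by (rule norm_le_l1_cart)
    also have "\<dots> \<le> (\<Sum>i\<in>(UNIV::'d set). K * (\<Sum>k\<in>UNIV. A k))"
    proof (rule sum_mono)
      fix i
      have "\<bar>Jac (fst z) i \<bullet> ref_grad c (Fi (fst z)) (snd z / T)\<bar>
          \<le> norm (Jac (fst z) i) * norm (ref_grad c (Fi (fst z)) (snd z / T))"
        by (rule Cauchy_Schwarz_ineq2)
      also have "\<dots> \<le> K * (\<Sum>k\<in>UNIV. A k)"
        using K[OF S_spaceD(1)[OF z], of i] by (intro mult_mono g) (auto intro: order_trans[OF norm_ge_zero])
      finally show "\<bar>space_grad (phys c) z $ i\<bar> \<le> K * (\<Sum>k\<in>UNIV. A k)"
        by (simp add: space_grad_phys[OF z])
    qed
    finally show ?thesis .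
  qed
  then show ?thesis by blast
qed

text \<open>Starting on the face where one coordinate is 0, the spline vanishes by the lateral
  condition. Along the line from there to \<zeta> it is continuous with derivative 0 off finitely
  many knots, hence it stays 0.\<close>

lemma ref_zero_if_grad_zero:
  assumes c: "c \<in> adm" and g: "\<And>\<zeta>. \<zeta> \<in> sp_generic Zs \<Longrightarrow> ref_grad c \<zeta> \<tau> = 0"
    and t: "\<tau> \<in> {0<..<1}" and z: "\<zeta> \<in> sp_generic Zs"
  shows "ref c \<zeta> \<tau> = 0"
proof -
  fix k0 :: 'd
  define w where "w s = \<zeta> + (s - \<zeta> $ k0) *\<^sub>R axis k0 1" for s
  have w_nth: "w s $ l = (if l = k0 then s else \<zeta> $ l)" for s l
    by (simp add: w_def axis_def)
  have zl: "0 < \<zeta> $ l" "\<zeta> $ l < 1" for l using z sp_generic_subset by (auto simp: unit_cube_def)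
  have "ref c (w (\<zeta> $ k0)) \<tau> = 0"
  proof (rule has_derivative_zero_unique_strong_interval[where f = "\<lambda>s. ref c (w s) \<tau>" and a = 0 and b = 1
        and k = "{0, 1} \<union> set (Zs k0)"])
    show "continuous_on {0..1} (\<lambda>s. ref c (w s) \<tau>)"
    proof (rule continuous_on_compose2[OF ref_space_cont])
      show "continuous_on {0..1} w" unfolding w_def by (intro continuous_intros)
      show "w ` {0..1} \<subseteq> cbox 0 1"
        using zl by (auto simp: mem_box_cart w_nth less_eq_real_def)
    qed
    have "w 0 \<in> unit_cube_boundary"
      using zl by (auto simp: unit_cube_boundary_def w_nth less_eq_real_def intro!: exI[of _ k0])
    then show "ref c (w 0) \<tau> = 0" using c t by (auto simp: adm_def)
    show "\<zeta> $ k0 \<in> {0..1}" using zl[of k0] by auto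
    fix s assume s: "s \<in> {0..1} - ({0, 1} \<union> set (Zs k0))"
    \<comment> \<open>Only coordinate \<open>k0\<close> moves; the others remain those of \<zeta>,
      off their knots.\<close>
    then have ws: "w s \<in> sp_generic Zs"
      using z by (auto simp: sp_generic_def w_nth knot_free_def)
    have "(w has_derivative (\<lambda>h. h *\<^sub>R axis k0 1)) (at s)"
      unfolding w_def by (auto intro!: derivative_eq_intros)
    from has_derivative_compose[OF this ref_has_derivative[OF ws]]
    have "((\<lambda>s. ref c (w s) \<tau>) has_derivative (\<lambda>h. (h *\<^sub>R axis k0 1) \<bullet> ref_grad c (w s) \<tau>)) (at s)" .
    then show "((\<lambda>s. ref c (w s) \<tau>) has_derivative (\<lambda>h. 0)) (at s within {0..1})"
      using g[OF ws] has_derivative_at_withinI by auto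
  qed simp
  moreover have "w (\<zeta> $ k0) = \<zeta>" by (simp add: w_def)
  ultimately show ?thesis by simp
qed

text \<open>The reference gradient is continuous on \<open>S\<close>, so the set \<open>U\<close>
  where it is nonzero is open. There the physical gradient is nonzero as well, so \<open>U\<close>
  is a null set, and an open null set is empty.\<close>

lemma phys_zero_if_grad_zero:
  assumes c: "c \<in> adm" and ae: "AE z in lborel. z \<in> S \<longrightarrow> space_grad (phys c) z = 0" and z: "z \<in> S"
  shows "phys c z = 0"
proof -
  let ?g = "\<lambda>z. ref_grad c (Fi (fst z)) (snd z / T)"
  have cont: "continuous_on S ?g"
    unfolding ref_grad_def
  proof (intro continuous_on_vec_lambda continuous_on_sum continuous_on_mult continuous_on_const)
    fix i k assume i: "i \<in> st_index"
    have "continuous_on S (\<lambda>z. Fi (fst z))"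
      by (rule continuous_on_compose2[OF Fi_cont]) (use S_spaceD in \<open>auto intro!: continuous_on_fst\<close>)
    then show "continuous_on S (\<lambda>z. sp_basis_pderiv Zs qs (fst i) k (Fi (fst z)))"
      by (rule continuous_on_compose2[OF sp_basis_pderiv_continuous[OF knots_s qs sp_index_st(1)[OF i]]])
        (use S_spaceD regular_Fi in blast)
    show "continuous_on S (\<lambda>z. bspline Zt qt (snd i) (snd z / T))"
      by (rule continuous_on_compose2[OF time_basis_cont[OF i]])
        (use T_pos S_timeD in \<open>auto intro!: continuous_on_snd continuous_on_divide continuous_on_const\<close>)
  qed
  define U where "U = S \<inter> ?g -` (- {0})"
  have "open U"
    unfolding U_def by (intro continuous_open_preimage cont open_S) auto
  have nz: "space_grad (phys c) z \<noteq> 0" if "z \<in> U" for z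
  proof
    assume "space_grad (phys c) z = 0"
    then have "Jac (fst z) i \<bullet> ?g z = 0" for i
      using that space_grad_phys[of z c] by (auto simp: U_def vec_eq_iff)
    then have "?g z = 0" using Jac_total[of "fst z"] that S_spaceD by (auto simp: U_def)
    then show False using that by (auto simp: U_def)
  qed
  have "AE z in lborel. z \<notin> U"
    using ae by (rule eventually_mono) (use nz in \<open>auto simp: U_def\<close>)
  then have "U \<in> null_sets lborel"
    using \<open>open U\<close> AE_iff_null_sets[of U lborel] by auto
  then have "negligible U" by (metis negligible_iff_null_sets null_sets_completionI)
  then have "U = {}" using \<open>open U\<close> open_not_negligible by blast
  then have g: "?g z = 0" if "z \<in> S" for z using that by (auto simp: U_def)
  \<comment> \<open>Since \<open>S\<close> is a product, every generic \<zeta> may be combined with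
    the time of z; the claim then concerns a single time slice.\<close>
  have "ref_grad c \<zeta> (snd z / T) = 0" if "\<zeta> \<in> sp_generic Zs" for \<zeta>
  proof -
    have "(F \<zeta>, snd z) \<in> S" using that z by (auto simp: S_def regular_def)
    from g[OF this] show ?thesis using that sp_generic_subset[of Zs] by auto
  qed
  then show ?thesis
    unfolding phys_def
    by (rule ref_zero_if_grad_zero[OF c]) (use z S_timeD[OF z] S_spaceD[OF z] regular_Fi in \<open>auto simp: knot_free_def\<close>)
qed

end

section \<open>Weak formulation\<close>

text \<open>Continuity holds only on [0,1], but the spatial mean is handled as a function of every
  real time.\<close>

lemma bspline_measurable [measurable]: "bspline Z p i \<in> borel_measurable borel"
proof (induction p arbitrary: i)
  case 0
  have "bspline Z 0 i = (\<lambda>x. if (Z!i \<le> x \<and> x < Z!(i+1)) \<or> (Z!i < Z!(i+1) \<and> x = Z!(i+1) \<and> Z!(i+1) = last Z) then 1 else 0)"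
    by (simp add: fun_eq_iff)
  then show ?case by simp
next
  case (Suc p)
  have "bspline Z (Suc p) i = (\<lambda>x. (x - Z!i) / (Z!(i+p+1) - Z!i) * bspline Z p i x
     + (Z!(i+p+2) - x) / (Z!(i+p+2) - Z!(i+1)) * bspline Z p (i+1) x)"
    by (simp add: fun_eq_iff)
  then show ?case using Suc[of i, measurable] Suc[of "i+1", measurable] by simp
qed

section \<open>Measurability and integrability on the space-time cylinder\<close>

context iga_space
begin

definition N :: "((real^'d) \<times> real) measure" where "N = restrict_space lborel W"

lemma W_sets: "W \<inter> space lborel \<in> sets lborel" using open_W by simp

lemma integral_N: "integral\<^sup>L N h = set_lebesgue_integral lborel W h" for h :: "_ \<Rightarrow> real"
  unfolding N_def set_lebesgue_integral_def by (rule integral_restrict_space[OF W_sets])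

lemma measurable_N_iff: "h \<in> borel_measurable N \<longleftrightarrow> (\<lambda>z. indicator W z * h z) \<in> borel_measurable borel" for h :: "_ \<Rightarrow> real"
  unfolding N_def borel_measurable_restrict_space_iff[OF W_sets] by simp

lemma space_N: "space N = W" by (simp add: N_def space_restrict_space)

lemma finite_measure_N: "finite_measure N"
proof
  have "bounded W" unfolding W_def using bounded_dom by (intro bounded_Times) auto
  then have "emeasure lborel W < \<infinity>" by (rule emeasure_bounded_finite)
  then show "emeasure N (space N) \<noteq> \<infinity>"
    unfolding space_N unfolding N_def by (subst emeasure_restrict_space) (use open_W in auto)
qed

lemma AE_regular: "AE x in lborel. x \<in> \<Omega> \<longrightarrow> x \<in> regular"
proof -
  have "\<Omega> - regular \<in> null_sets lborel"
    using negligible_exceptional open_dom open_regular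
    by (simp add: negligible_iff_null_sets null_sets_completion_iff)
  then show ?thesis by (auto dest: AE_not_in elim: eventually_mono)
qed

lemma AE_regular_times: "AE t in lborel. t \<in> {0<..<T} \<longrightarrow> t \<in> regular_times"
  using AE_not_in[OF finite_imp_null_set_lborel[OF regular_times_cofinite]] by (auto elim: eventually_mono)

text \<open>By Fubini it suffices that almost every x is regular and that, for each regular x, all
  but finitely many times are.\<close>

lemma AE_S: "AE z in N. z \<in> S"
proof -
  have "AE z in lborel \<Otimes>\<^sub>M lborel. z \<in> W \<longrightarrow> z \<in> S"
  proof (rule lborel_pair.AE_pair_measure)
    have "{z \<in> space (lborel \<Otimes>\<^sub>M lborel). z \<in> W \<longrightarrow> z \<in> S} = - W \<union> S"
      by (auto simp: space_pair_measure)
    then show "{z \<in> space (lborel \<Otimes>\<^sub>M lborel). z \<in> W \<longrightarrow> z \<in> S} \<in> sets (lborel \<Otimes>\<^sub>M lborel)"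
      using open_W open_S unfolding lborel_prod by simp
    show "AE x in lborel. AE y in lborel. (x, y) \<in> W \<longrightarrow> (x, y) \<in> S"
      using AE_regular
    proof eventually_elim
      case (elim x)
      show ?case using AE_regular_times by eventually_elim (use elim in \<open>auto simp: W_def S_def\<close>)
    qed
  qed
  then show ?thesis
    unfolding N_def lborel_prod by (subst AE_restrict_space_iff[OF W_sets])
qed

lemma integrable_N_bounded:
  fixes h :: "_ \<Rightarrow> real"
  assumes "h \<in> borel_measurable N" "\<exists>K. \<forall>z\<in>S. \<bar>h z\<bar> \<le> K"
  shows "integrable N h"
proof -
  interpret finite_measure N by (rule finite_measure_N)
  obtain K where K: "\<And>z. z \<in> S \<Longrightarrow> \<bar>h z\<bar> \<le> K" using assms(2) by blast
  have "AE z in N. norm (h z) \<le> K" using AE_S by eventually_elim (simp add: K)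
  then show ?thesis using assms(1) by (rule integrable_const_bound)
qed

lemma phys_meas [measurable]: "phys c \<in> borel_measurable N"
  unfolding measurable_N_iff
  using borel_measurable_continuous_on_indicator[OF _ phys_cont, of c] open_W by simp

text \<open>The time derivative is the directional derivative along (0,1) of a function continuous
  on the open cylinder, which gives joint measurability in space and time.\<close>

lemma time_deriv_meas [measurable]: "time_deriv (phys c) \<in> borel_measurable N"
proof -
  have "time_deriv (phys c) z = deriv (\<lambda>s. phys c (z + s *\<^sub>R (0, 1))) 0" for z
    unfolding time_deriv_def by (subst deriv_shift_0) (simp add: plus_prod_def scaleR_prod_def)
  then show ?thesis
    unfolding measurable_N_iff using borel_measurable_directional_deriv[OF open_W phys_cont, of c "(0, 1)"] by simp
qed

lemma space_grad_meas [measurable]: "(\<lambda>z. space_grad (phys c) z $ i) \<in> borel_measurable N"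
proof -
  have "space_grad (phys c) z $ i = deriv (\<lambda>s. phys c (z + s *\<^sub>R (axis i 1, 0))) 0" for z
    unfolding space_grad_def by (simp add: plus_prod_def scaleR_prod_def)
  then show ?thesis
    unfolding measurable_N_iff using borel_measurable_directional_deriv[OF open_W phys_cont, of c "(axis i 1, 0)"] by simp
qed

lemma integrable_time: "integrable N (\<lambda>z. time_deriv (phys c) z * phys c' z)"
proof (rule integrable_N_bounded)
  show "\<exists>K. \<forall>z\<in>S. \<bar>time_deriv (phys c) z * phys c' z\<bar> \<le> K"
    using phys_bounded[of c'] S_W by (intro bounded_on_mult time_deriv_bounded) blast
qed measurable

lemma grad_inner_meas [measurable]: "(\<lambda>z. space_grad (phys c) z \<bullet> space_grad (phys c') z) \<in> borel_measurable N"
  unfolding inner_vec_def by measurable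

lemma integrable_grad: "integrable N (\<lambda>z. space_grad (phys c) z \<bullet> space_grad (phys c') z)"
proof (rule integrable_N_bounded)
  obtain A B where A: "\<And>z. z \<in> S \<Longrightarrow> norm (space_grad (phys c) z) \<le> A"
    and B: "\<And>z. z \<in> S \<Longrightarrow> norm (space_grad (phys c') z) \<le> B"
    using space_grad_bounded by metis
  have "\<bar>space_grad (phys c) z \<bullet> space_grad (phys c') z\<bar> \<le> A * B" if "z \<in> S" for z
    by (rule order_trans[OF Cauchy_Schwarz_ineq2])
      (intro mult_mono A[OF that] B[OF that] norm_ge_zero order_trans[OF norm_ge_zero A[OF that]])
  then show "\<exists>K. \<forall>z\<in>S. \<bar>space_grad (phys c) z \<bullet> space_grad (phys c') z\<bar> \<le> K" by blast
qed measurable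

text \<open>The test function is bounded and the cylinder has finite measure, so square
  integrability suffices through |s| \<le> 1 + s^2, a consequence of (|s| - 1)^2 \<ge> 0.\<close>

lemma integrable_load:
  assumes "set_borel_measurable lborel W f" "set_integrable lborel W (\<lambda>z. (f z)\<^sup>2)"
  shows "integrable N (\<lambda>z. f z * phys c z)"
proof -
  interpret finite_measure N by (rule finite_measure_N)
  have fm: "f \<in> borel_measurable N"
    using assms(1) unfolding set_borel_measurable_def measurable_N_iff by simp
  have f2: "integrable N (\<lambda>z. (f z)\<^sup>2)"
    using assms(2) unfolding set_integrable_def N_def by (simp add: integrable_restrict_space[OF W_sets])
  obtain K where K: "\<And>z. z \<in> W \<Longrightarrow> \<bar>phys c z\<bar> \<le> K" using phys_bounded by blast
  show ?thesis
  proof (rule Bochner_Integration.integrable_bound[where f = "\<lambda>z. K * (1 + (f z)\<^sup>2)"])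
    show "integrable N (\<lambda>z. K * (1 + (f z)\<^sup>2))" using f2 by simp
    show "(\<lambda>z. f z * phys c z) \<in> borel_measurable N" using fm by measurable
    show "AE z in N. norm (f z * phys c z) \<le> norm (K * (1 + (f z)\<^sup>2))"
    proof (rule AE_I2)
      fix z assume "z \<in> space N"
      then have k: "\<bar>phys c z\<bar> \<le> K" using K space_N by auto
      have "\<bar>f z\<bar> \<le> 1 + (f z)\<^sup>2"
      proof -
        have "0 \<le> (\<bar>f z\<bar> - 1)\<^sup>2" by simp
        then have "2 * \<bar>f z\<bar> \<le> 1 + (f z)\<^sup>2" by (simp add: power2_eq_square algebra_simps)
        then show ?thesis by linarith
      qed
      then have "\<bar>phys c z\<bar> * \<bar>f z\<bar> \<le> K * (1 + (f z)\<^sup>2)"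
        using k by (intro mult_mono) (auto intro: order_trans[OF abs_ge_zero])
      then show "norm (f z * phys c z) \<le> norm (K * (1 + (f z)\<^sup>2))"
        using order_trans[OF abs_ge_zero k] by (simp add: abs_mult mult.commute)
    qed
  qed
qed

lemma sp_basis_Fi_integrable:
  assumes "j \<in> sp_index Zs qs"
  shows "set_integrable lborel \<Omega> (\<lambda>x. sp_basis Zs qs j (Fi x))"
  unfolding set_integrable_def
proof -
  obtain K where K: "\<And>x. x \<in> \<Omega> \<Longrightarrow> \<bar>sp_basis Zs qs j (Fi x)\<bar> \<le> K" using sp_basis_bounded_Fi[OF assms] by blast
  have fin: "emeasure lborel \<Omega> < \<infinity>" using bounded_dom by (rule emeasure_bounded_finite)
  show "integrable lborel (\<lambda>x. indicator \<Omega> x *\<^sub>R sp_basis Zs qs j (Fi x))"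
  proof (rule Bochner_Integration.integrable_bound[where f = "\<lambda>x. K * indicator \<Omega> x"])
    show "integrable lborel (\<lambda>x. K * indicator \<Omega> x)" using fin open_dom by simp
    show "(\<lambda>x. indicator \<Omega> x *\<^sub>R sp_basis Zs qs j (Fi x)) \<in> borel_measurable lborel"
      using borel_measurable_continuous_on_indicator[OF _ sp_basis_Fi_cont[OF assms]] open_dom by simp
    show "AE x in lborel. norm (indicator \<Omega> x *\<^sub>R sp_basis Zs qs j (Fi x)) \<le> norm (K * indicator \<Omega> x)"
      using K by (intro AE_I2) (fastforce simp: indicator_def)
  qed
qed

text \<open>The spatial integral acts on the spatial factors alone, so the mean is a spline in time.
  This gives its measurability and its linearity at every time, not just almost every one.\<close>

lemma lmean_phys:
  "lmean \<Omega> (phys c) t = (\<Sum>i\<in>st_index. c i *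
     (set_lebesgue_integral lborel \<Omega> (\<lambda>x. sp_basis Zs qs (fst i) (Fi x)) * bspline Zt qt (snd i) (t / T)))"
proof -
  have int: "integrable lborel (\<lambda>x. indicator \<Omega> x *\<^sub>R sp_basis Zs qs (fst i) (Fi x))" if "i \<in> st_index" for i
    using sp_basis_Fi_integrable[OF sp_index_st(1)[OF that]] by (simp add: set_integrable_def)
  have "lmean \<Omega> (phys c) t = (\<integral>x. (\<Sum>i\<in>st_index. c i * bspline Zt qt (snd i) (t / T) *
      (indicator \<Omega> x *\<^sub>R sp_basis Zs qs (fst i) (Fi x))) \<partial>lborel)"
    unfolding lmean_def set_lebesgue_integral_def phys_def ref_def
    by (intro Bochner_Integration.integral_cong refl) (simp add: sum_distrib_left ac_simps)
  also have "\<dots> = (\<Sum>i\<in>st_index. \<integral>x. c i * bspline Zt qt (snd i) (t / T) *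
      (indicator \<Omega> x *\<^sub>R sp_basis Zs qs (fst i) (Fi x)) \<partial>lborel)"
    using int by (intro Bochner_Integration.integral_sum integrable_mult_right)
  also have "\<dots> = (\<Sum>i\<in>st_index. c i * bspline Zt qt (snd i) (t / T) *
      set_lebesgue_integral lborel \<Omega> (\<lambda>x. sp_basis Zs qs (fst i) (Fi x)))"
    by (simp only: integral_mult_right_zero set_lebesgue_integral_def)
  finally show ?thesis by (simp add: ac_simps)
qed

lemma lmean_linear:
  "lmean \<Omega> (phys (\<lambda>j. \<Sum>k\<in>A. r k * \<gamma> k j)) t = (\<Sum>k\<in>A. r k * lmean \<Omega> (phys (\<gamma> k)) t)"
  unfolding lmean_phys sum_distrib_left sum_distrib_right
  by (subst sum.swap) (simp add: mult.assoc)

lemma lmean_meas: "(\<lambda>z. lmean \<Omega> (phys c) (snd z)) \<in> borel_measurable N"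
proof -
  have "(\<lambda>z :: (real^'d) \<times> real. lmean \<Omega> (phys c) (snd z)) \<in> borel_measurable borel"
    unfolding lmean_phys
    by (intro borel_measurable_sum borel_measurable_times borel_measurable_const
        measurable_compose[OF _ bspline_measurable] borel_measurable_continuous_onI continuous_intros)
      (use T_pos in auto)
  then show ?thesis unfolding measurable_N_iff using open_W by simp
qed

text \<open>For fixed x the integrand is the time derivative of half the square, so the time
  integral is u(x,T)^2/2 because u(x,0) = 0. Fubini then integrates over x.\<close>

lemma time_form_nonneg:
  assumes c: "c \<in> adm"
  shows "0 \<le> (\<integral>z. time_deriv (phys c) z * phys c z \<partial>N)"
proof -
  let ?h = "\<lambda>z. indicator W z *\<^sub>R (time_deriv (phys c) z * phys c z)"
  have int: "integrable (lborel \<Otimes>\<^sub>M lborel) ?h"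
    using integrable_time[of c c] unfolding N_def lborel_prod by (simp add: integrable_restrict_space[OF W_sets])
  have inside: "0 \<le> (\<integral>t. ?h (x, t) \<partial>lborel)" if x: "x \<in> \<Omega>" for x
  proof -
    let ?g = "\<lambda>t. time_deriv (phys c) (x, t) * phys c (x, t)"
    have eq: "(\<lambda>t. ?h (x, t)) = (\<lambda>t. indicator {0<..<T} t *\<^sub>R ?g t)"
      using x by (auto simp: W_def indicator_def fun_eq_iff)
    show ?thesis
    \<comment> \<open>The sign is wanted for every x. If a slice is not integrable, its Bochner
      integral is 0 by default, which is nonnegative too.\<close>
    proof (cases "set_integrable lborel {0<..<T} ?g")
      case True
      have cont: "continuous_on {0..T} (\<lambda>t. phys c (x, t))"
        unfolding phys_def fst_conv snd_conv
        by (rule continuous_on_compose2[OF ref_time_cont])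
          (use T_pos in \<open>auto simp: divide_le_eq_1 intro!: continuous_on_divide continuous_on_const continuous_on_id\<close>)
      \<comment> \<open>The fundamental theorem with a finite exceptional set: differentiability may
        fail at the images of the time knots, where continuity suffices.\<close>
      have "(?g has_integral ((phys c (x, T))\<^sup>2 / 2 - (phys c (x, 0))\<^sup>2 / 2)) {0..T}"
      proof (rule fundamental_theorem_of_calculus_interior_strong[OF regular_times_cofinite])
        show "continuous_on {0..T} (\<lambda>t. (phys c (x, t))\<^sup>2 / 2)"
          by (intro continuous_intros cont) auto
        fix t assume "t \<in> {0<..<T} - ({0<..<T} - regular_times)"
        then have t: "t \<in> regular_times" by auto
        have d: "((\<lambda>s. phys c (x, s)) has_real_derivative time_deriv (phys c) (x, t)) (at t)"
          using phys_time_has_deriv[OF t, of c x] DERIV_imp_deriv[OF phys_time_has_deriv[OF t, of c x]]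
          by (simp add: time_deriv_def)
        have "((\<lambda>t. (phys c (x, t))\<^sup>2 / 2) has_real_derivative ?g t) (at t)"
          using DERIV_cdivide[OF DERIV_power[OF d, of 2], of 2] by simp
        then show "((\<lambda>t. (phys c (x, t))\<^sup>2 / 2) has_vector_derivative ?g t) (at t)"
          by (simp add: has_real_derivative_iff_has_vector_derivative)
      qed (use T_pos in auto)
      moreover have "phys c (x, 0) = 0" using c Fi_cube[OF x] by (simp add: phys_def adm_def)
      ultimately have eqT: "integral {0..T} ?g = (phys c (x, T))\<^sup>2 / 2" by (simp add: integral_unique)
      have "0 \<le> integral {0..T} ?g" unfolding eqT by simp
      then have "0 \<le> integral {0<..<T} ?g" unfolding integral_open_interval_real .
      then have "0 \<le> set_lebesgue_integral lborel {0<..<T} ?g"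
        using set_borel_integral_eq_integral(2)[OF True] by simp
      then show ?thesis unfolding eq set_lebesgue_integral_def .
    next
      case False
      then show ?thesis unfolding eq set_integrable_def by (subst not_integrable_integral_eq) simp_all
    qed
  qed
  have outside: "(\<integral>t. ?h (x, t) \<partial>lborel) = 0" if "x \<notin> \<Omega>" for x
    using that by (simp add: W_def)
  have nn: "0 \<le> (\<integral>t. ?h (x, t) \<partial>lborel)" for x
  proof (cases "x \<in> \<Omega>")
    case True
    then show ?thesis by (rule inside)
  next
    case False
    show ?thesis unfolding outside[OF False] by (rule order_refl)
  qed
  have "0 \<le> (\<integral>x. (\<integral>t. ?h (x, t) \<partial>lborel) \<partial>lborel)"
    by (rule Bochner_Integration.integral_nonneg) (rule nn)
  also have "\<dots> = integral\<^sup>L (lborel \<Otimes>\<^sub>M lborel) ?h" by (rule lborel_pair.integral_fst'[OF int])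
  also have "\<dots> = (\<integral>z. time_deriv (phys c) z * phys c z \<partial>N)"
    unfolding N_def lborel_prod by (rule integral_restrict_space[OF W_sets, symmetric])
  finally show ?thesis .
qed


section \<open>A basis on the regular set and the Galerkin system\<close>

lemma space_grad_cong:
  assumes eq: "\<And>z. z \<in> S \<Longrightarrow> phys c z = phys c' z" and z: "z \<in> S"
  shows "space_grad (phys c) z = space_grad (phys c') z"
proof -
  have "deriv (\<lambda>s. phys c (fst z + s *\<^sub>R axis i 1, snd z)) 0 = deriv (\<lambda>s. phys c' (fst z + s *\<^sub>R axis i 1, snd z)) 0" for i
  proof (rule deriv_cong_ev[OF _ refl])
    show "eventually (\<lambda>s. phys c (fst z + s *\<^sub>R axis i 1, snd z) = phys c' (fst z + s *\<^sub>R axis i 1, snd z)) (nhds 0)"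
      using line_in_regular[OF S_spaceD(1)[OF z], of i]
      by (rule eventually_mono) (use z in \<open>auto simp: S_def intro!: eq\<close>)
  qed
  then show ?thesis by (simp add: space_grad_def)
qed

text \<open>Independence is required on \<open>S\<close> only, because a vanishing gradient form
  forces a combination to vanish just there. Independence as functions on all of space-time would be
  too weak, the values outside \<Omega> being arbitrary.\<close>

lemma phys_basis:
  "\<exists>(n::nat) \<gamma>. (\<forall>i<n. \<gamma> i \<in> adm) \<and>
     (\<forall>c\<in>adm. \<exists>r. \<forall>z\<in>S. phys c z = (\<Sum>i<n. r i * phys (\<gamma> i) z)) \<and>
     (\<forall>r. (\<forall>z\<in>S. (\<Sum>i<n. r i * phys (\<gamma> i) z) = 0) \<longrightarrow> (\<forall>i<n. r i = 0))"
proof -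
  \<comment> \<open>Extension by 0 turns restriction to \<open>S\<close> into a function on the full
    type, to which the basis lemma applies.\<close>
  define res where "res c z = (if z \<in> S then phys c z else 0)" for c z
  define \<psi> where "\<psi> i z = (if z \<in> S then sp_basis Zs qs (fst i) (Fi (fst z)) * bspline Zt qt (snd i) (snd z / T) else 0)" for i z
  have "\<exists>c. \<forall>z. v z = (\<Sum>i\<in>st_index. c i * \<psi> i z)" if v: "v \<in> res ` adm" for v
  proof -
    obtain c where "v = res c" using v by (elim imageE)
    then have "\<forall>z. v z = (\<Sum>i\<in>st_index. c i * \<psi> i z)"
      by (simp add: res_def \<psi>_def phys_def ref_def)
    then show ?thesis by blast
  qed
  from function_space_basis[OF finite_st_index this]
  obtain n :: nat and b where b: "\<forall>i<n. b i \<in> res ` adm" "\<forall>v\<in>res ` adm. \<exists>r. \<forall>z. v z = (\<Sum>i<n. r i * b i z)"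
    "\<forall>r. (\<forall>z. (\<Sum>i<n. r i * b i z) = 0) \<longrightarrow> (\<forall>i<n. r i = 0)"
    by blast
  define \<gamma> where "\<gamma> i = (SOME c. c \<in> adm \<and> b i = res c)" for i
  have g: "\<gamma> i \<in> adm \<and> b i = res (\<gamma> i)" if "i < n" for i
  proof -
    have "\<exists>c. c \<in> adm \<and> b i = res c"
      using b(1)[rule_format, OF that] by (elim imageE) (rule exI, rule conjI)
    then show ?thesis unfolding \<gamma>_def by (rule someI_ex)
  qed
  have sum_eq: "(\<Sum>i<n. r i * b i z) = (if z \<in> S then \<Sum>i<n. r i * phys (\<gamma> i) z else 0)" for r z
    using g by (simp add: res_def)
  show ?thesis
  proof (intro exI[of _ n] exI[of _ \<gamma>] conjI allI impI ballI)
    fix c assume "c \<in> adm"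
    from b(2)[THEN bspec, OF imageI[OF this]]
    obtain r where r: "\<forall>z. res c z = (\<Sum>i<n. r i * b i z)" by (elim exE)
    have "phys c z = (\<Sum>i<n. r i * phys (\<gamma> i) z)" if "z \<in> S" for z
      using r[rule_format, of z] that unfolding sum_eq by (simp add: res_def)
    then show "\<exists>r. \<forall>z\<in>S. phys c z = (\<Sum>i<n. r i * phys (\<gamma> i) z)" by blast
  next
    fix r i assume r: "\<forall>z\<in>S. (\<Sum>i<n. r i * phys (\<gamma> i) z) = 0" and i: "i < n"
    have "\<forall>z. (\<Sum>i<n. r i * b i z) = 0" unfolding sum_eq using r by simp
    then show "r i = 0" using b(3) i by blast
  qed (use g in blast)
qed

text \<open>The abstract system is solved for a basis on \<open>S\<close>. Its equations for the
  basis functions extend to every test function because the integrands agree on \<open>S\<close>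
  with linear combinations.\<close>

lemma galerkin_solution:
  fixes a :: "real \<Rightarrow> real" and f :: "(real^'d) \<times> real \<Rightarrow> real"
  assumes a_cont: "continuous_on UNIV a" and a_bd: "0 < m" "\<And>s. m \<le> a s" "\<And>s. a s \<le> M"
    and f: "set_borel_measurable lborel W f" "set_integrable lborel W (\<lambda>z. (f z)\<^sup>2)"
  shows "\<exists>c\<in>adm. \<forall>c'\<in>adm. (\<integral>z. time_deriv (phys c) z * phys c' z \<partial>N)
    + (\<integral>z. a (lmean \<Omega> (phys c) (snd z)) * (space_grad (phys c) z \<bullet> space_grad (phys c') z) \<partial>N)
    = (\<integral>z. f z * phys c' z \<partial>N)"
proof -
  obtain n :: nat and \<gamma> where adm: "\<And>i. i < n \<Longrightarrow> \<gamma> i \<in> adm"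
    and span: "\<And>c. c \<in> adm \<Longrightarrow> \<exists>r. \<forall>z\<in>S. phys c z = (\<Sum>i<n. r i * phys (\<gamma> i) z)"
    and indep: "\<And>r. \<forall>z\<in>S. (\<Sum>i<n. r i * phys (\<gamma> i) z) = 0 \<Longrightarrow> \<forall>i<n. r i = 0"
    using phys_basis by blast
  \<comment> \<open>Combining coefficients instead of functions keeps the result in
    \<open>adm\<close>. Values and means then combine everywhere, derivatives on \<open>S\<close>,
    so the integrals below are compared almost everywhere.\<close>
  define comb where "comb r = (\<lambda>j. \<Sum>i<n. r i * \<gamma> i j)" for r
  have comb_adm: "comb r \<in> adm" for r
    unfolding comb_def by (rule adm_linear) (use adm in auto)
  have comb_phys: "phys (comb r) z = (\<Sum>i<n. r i * phys (\<gamma> i) z)" for r z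
    unfolding comb_def by (rule phys_linear)
  have comb_lmean: "lmean \<Omega> (phys (comb r)) t = (\<Sum>i<n. r i * lmean \<Omega> (phys (\<gamma> i)) t)" for r t
    unfolding comb_def by (rule lmean_linear)
  have comb_dt: "time_deriv (phys (comb r)) z = (\<Sum>i<n. r i * time_deriv (phys (\<gamma> i)) z)" if "z \<in> S" for r z
    unfolding comb_def by (rule time_deriv_linear[OF that])
  have comb_grad: "space_grad (phys (comb r)) z = (\<Sum>i<n. r i *\<^sub>R space_grad (phys (\<gamma> i)) z)" if "z \<in> S" for r z
    unfolding comb_def by (rule space_grad_linear[OF that])
  have a_m[measurable]: "a \<in> borel_measurable borel"
    using a_cont by (rule borel_measurable_continuous_onI)
  note lmean_meas[measurable]
  have grad_sum_meas: "(\<lambda>z. (\<Sum>i<n. r i *\<^sub>R space_grad (phys (\<gamma> i)) z) $ k) \<in> borel_measurable N" for r k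
    by simp
  have nonneg: "0 \<le> (\<integral>z. (\<Sum>i<n. r i * time_deriv (phys (\<gamma> i)) z) * (\<Sum>j<n. r j * phys (\<gamma> j) z) \<partial>N)" for r
  proof -
    have "(\<integral>z. (\<Sum>i<n. r i * time_deriv (phys (\<gamma> i)) z) * (\<Sum>j<n. r j * phys (\<gamma> j) z) \<partial>N)
      = (\<integral>z. time_deriv (phys (comb r)) z * phys (comb r) z \<partial>N)"
    proof (rule integral_cong_AE)
      show "AE z in N. (\<Sum>i<n. r i * time_deriv (phys (\<gamma> i)) z) * (\<Sum>j<n. r j * phys (\<gamma> j) z)
          = time_deriv (phys (comb r)) z * phys (comb r) z"
        using AE_S by eventually_elim (simp add: comb_dt comb_phys)
    qed measurable
    then show ?thesis using time_form_nonneg[OF comb_adm] by simp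
  qed
  \<comment> \<open>A zero gradient integral makes the gradient of the combination vanish almost
    everywhere, hence the combination vanish on \<open>S\<close>, and independence gives zero
    coefficients.\<close>
  have pos: "\<forall>i<n. r i = 0"
    if z: "(\<integral>z. (norm (\<Sum>i<n. r i *\<^sub>R space_grad (phys (\<gamma> i)) z))\<^sup>2 \<partial>N) = 0" for r
  proof -
    have "(\<integral>z. (norm (\<Sum>i<n. r i *\<^sub>R space_grad (phys (\<gamma> i)) z))\<^sup>2 \<partial>N)
       = (\<integral>z. space_grad (phys (comb r)) z \<bullet> space_grad (phys (comb r)) z \<partial>N)"
    proof (rule integral_cong_AE)
      show "(\<lambda>z. (norm (\<Sum>i<n. r i *\<^sub>R space_grad (phys (\<gamma> i)) z))\<^sup>2) \<in> borel_measurable N"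
        unfolding power2_norm_eq_inner inner_vec_def inner_real_def
        by (intro borel_measurable_sum borel_measurable_times grad_sum_meas)
      show "AE z in N. (norm (\<Sum>i<n. r i *\<^sub>R space_grad (phys (\<gamma> i)) z))\<^sup>2
         = space_grad (phys (comb r)) z \<bullet> space_grad (phys (comb r)) z"
        using AE_S by eventually_elim (simp add: comb_grad power2_norm_eq_inner)
    qed measurable
    then have "AE z in N. space_grad (phys (comb r)) z \<bullet> space_grad (phys (comb r)) z = 0"
      using z integral_nonneg_eq_0_iff_AE[OF integrable_grad[of "comb r" "comb r"]] by simp
    then have "AE z in lborel. z \<in> W \<longrightarrow> space_grad (phys (comb r)) z = 0"
      unfolding N_def AE_restrict_space_iff[OF W_sets] by simp
    then have "AE z in lborel. z \<in> S \<longrightarrow> space_grad (phys (comb r)) z = 0"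
      by (rule eventually_mono) (use S_W in blast)
    then have "phys (comb r) z = 0" if "z \<in> S" for z
      using phys_zero_if_grad_zero[OF comb_adm _ that] by blast
    then show ?thesis unfolding comb_phys using indep by blast
  qed
  have "\<exists>c. \<forall>j<n. (\<integral>z. (\<Sum>i<n. c i * time_deriv (phys (\<gamma> i)) z) * phys (\<gamma> j) z \<partial>N)
     + (\<integral>z. a (\<Sum>k<n. c k * lmean \<Omega> (phys (\<gamma> k)) (snd z)) *
          ((\<Sum>i<n. c i *\<^sub>R space_grad (phys (\<gamma> i)) z) \<bullet> space_grad (phys (\<gamma> j)) z) \<partial>N)
     = (\<integral>z. f z * phys (\<gamma> j) z \<partial>N)"
    using a_cont a_bd lmean_meas integrable_time integrable_grad nonneg pos by (rule abstract_galerkin)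
  then obtain c where c: "\<And>j. j < n \<Longrightarrow> (\<integral>z. (\<Sum>i<n. c i * time_deriv (phys (\<gamma> i)) z) * phys (\<gamma> j) z \<partial>N)
     + (\<integral>z. a (\<Sum>k<n. c k * lmean \<Omega> (phys (\<gamma> k)) (snd z)) *
          ((\<Sum>i<n. c i *\<^sub>R space_grad (phys (\<gamma> i)) z) \<bullet> space_grad (phys (\<gamma> j)) z) \<partial>N)
     = (\<integral>z. f z * phys (\<gamma> j) z \<partial>N)"
    by blast
  let ?u = "phys (comb c)"
  let ?A = "\<lambda>z. a (lmean \<Omega> ?u (snd z))"
  have int_a: "integrable N (\<lambda>z. ?A z * (space_grad ?u z \<bullet> space_grad (phys c') z))" for c'
  proof (rule Bochner_Integration.integrable_bound[where f = "\<lambda>z. M * (space_grad ?u z \<bullet> space_grad (phys c') z)"])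
    show "integrable N (\<lambda>z. M * (space_grad ?u z \<bullet> space_grad (phys c') z))" using integrable_grad by simp
    show "(\<lambda>z. ?A z * (space_grad ?u z \<bullet> space_grad (phys c') z)) \<in> borel_measurable N" by measurable
    have "\<bar>a s\<bar> \<le> \<bar>M\<bar>" for s using a_bd(1) a_bd(2,3)[of s] by linarith
    then show "AE z in N. norm (?A z * (space_grad ?u z \<bullet> space_grad (phys c') z))
        \<le> norm (M * (space_grad ?u z \<bullet> space_grad (phys c') z))"
      by (auto simp: abs_mult intro!: mult_right_mono)
  qed
  have eq_j: "(\<integral>z. time_deriv ?u z * phys (\<gamma> j) z \<partial>N)
     + (\<integral>z. ?A z * (space_grad ?u z \<bullet> space_grad (phys (\<gamma> j)) z) \<partial>N) = (\<integral>z. f z * phys (\<gamma> j) z \<partial>N)"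
    if j: "j < n" for j
  proof -
    have "(\<integral>z. time_deriv ?u z * phys (\<gamma> j) z \<partial>N)
       = (\<integral>z. (\<Sum>i<n. c i * time_deriv (phys (\<gamma> i)) z) * phys (\<gamma> j) z \<partial>N)"
    proof (rule integral_cong_AE)
      show "AE z in N. time_deriv ?u z * phys (\<gamma> j) z = (\<Sum>i<n. c i * time_deriv (phys (\<gamma> i)) z) * phys (\<gamma> j) z"
        using AE_S by eventually_elim (simp add: comb_dt)
    qed measurable
    moreover have "(\<integral>z. ?A z * (space_grad ?u z \<bullet> space_grad (phys (\<gamma> j)) z) \<partial>N)
       = (\<integral>z. a (\<Sum>k<n. c k * lmean \<Omega> (phys (\<gamma> k)) (snd z)) *
          ((\<Sum>i<n. c i *\<^sub>R space_grad (phys (\<gamma> i)) z) \<bullet> space_grad (phys (\<gamma> j)) z) \<partial>N)"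
    proof (rule integral_cong_AE)
      show "(\<lambda>z. a (\<Sum>k<n. c k * lmean \<Omega> (phys (\<gamma> k)) (snd z)) *
          ((\<Sum>i<n. c i *\<^sub>R space_grad (phys (\<gamma> i)) z) \<bullet> space_grad (phys (\<gamma> j)) z)) \<in> borel_measurable N"
        unfolding inner_sum_left inner_scaleR_left by measurable
      show "AE z in N. ?A z * (space_grad ?u z \<bullet> space_grad (phys (\<gamma> j)) z)
        = a (\<Sum>k<n. c k * lmean \<Omega> (phys (\<gamma> k)) (snd z)) *
          ((\<Sum>i<n. c i *\<^sub>R space_grad (phys (\<gamma> i)) z) \<bullet> space_grad (phys (\<gamma> j)) z)"
        using AE_S by eventually_elim (simp add: comb_grad comb_lmean)
    qed measurable
    ultimately show ?thesis using c[OF j] by simp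
  qed
  have "(\<integral>z. time_deriv ?u z * phys c' z \<partial>N)
    + (\<integral>z. ?A z * (space_grad ?u z \<bullet> space_grad (phys c') z) \<partial>N) = (\<integral>z. f z * phys c' z \<partial>N)"
    if c': "c' \<in> adm" for c'
  proof -
    obtain r where r: "\<And>z. z \<in> S \<Longrightarrow> phys c' z = (\<Sum>i<n. r i * phys (\<gamma> i) z)" using span[OF c'] by blast
    have grad: "space_grad (phys c') z = (\<Sum>i<n. r i *\<^sub>R space_grad (phys (\<gamma> i)) z)" if "z \<in> S" for z
    proof -
      have "space_grad (phys c') z = space_grad (phys (comb r)) z"
        by (rule space_grad_cong[OF _ that]) (simp add: r comb_phys)
      then show ?thesis using comb_grad[OF that] by simp
    qed
    \<comment> \<open>Linearity in the test function, common to the time, diffusion and load terms.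
      Measurability of \<open>h\<close> is a separate premise, since agreement on \<open>S\<close>
      alone determines it only up to a null set.\<close>
    have expand: "(\<integral>z. h z \<partial>N) = (\<Sum>i<n. r i * (\<integral>z. k i z \<partial>N))"
      if "h \<in> borel_measurable N" "\<And>i. integrable N (k i)" "\<And>z. z \<in> S \<Longrightarrow> h z = (\<Sum>i<n. r i * k i z)"
      for h :: "(real^'d) \<times> real \<Rightarrow> real" and k
    proof -
      have "(\<integral>z. h z \<partial>N) = (\<integral>z. (\<Sum>i<n. r i * k i z) \<partial>N)"
      proof (rule integral_cong_AE)
        show "(\<lambda>z. \<Sum>i<n. r i * k i z) \<in> borel_measurable N"
          using that(2) by (intro borel_measurable_sum borel_measurable_times borel_measurable_const) auto
        show "AE z in N. h z = (\<Sum>i<n. r i * k i z)"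
          using AE_S by eventually_elim (rule that(3))
      qed (rule that(1))
      also have "\<dots> = (\<Sum>i<n. r i * (\<integral>z. k i z \<partial>N))"
        using that(2) by (subst Bochner_Integration.integral_sum) auto
      finally show ?thesis .
    qed
    have fm: "integrable N (\<lambda>z. f z * phys c z)" for c
      using f by (rule integrable_load)
    have 1: "(\<integral>z. time_deriv ?u z * phys c' z \<partial>N) = (\<Sum>i<n. r i * (\<integral>z. time_deriv ?u z * phys (\<gamma> i) z \<partial>N))"
    proof (rule expand)
      show "integrable N (\<lambda>z. time_deriv ?u z * phys (\<gamma> i) z)" for i by (rule integrable_time)
    qed (simp_all add: r sum_distrib_left ac_simps)
    have 2: "(\<integral>z. ?A z * (space_grad ?u z \<bullet> space_grad (phys c') z) \<partial>N)
       = (\<Sum>i<n. r i * (\<integral>z. ?A z * (space_grad ?u z \<bullet> space_grad (phys (\<gamma> i)) z) \<partial>N))"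
    proof (rule expand)
      show "(\<lambda>z. ?A z * (space_grad ?u z \<bullet> space_grad (phys c') z)) \<in> borel_measurable N" by measurable
    qed (simp_all add: int_a grad inner_sum_right sum_distrib_left ac_simps)
    have 3: "(\<integral>z. f z * phys c' z \<partial>N) = (\<Sum>i<n. r i * (\<integral>z. f z * phys (\<gamma> i) z \<partial>N))"
    proof (rule expand)
      show "integrable N (\<lambda>z. f z * phys (\<gamma> i) z)" for i by (rule fm)
      show "(\<lambda>z. f z * phys c' z) \<in> borel_measurable N" using fm by (rule borel_measurable_integrable)
    qed (simp add: r sum_distrib_left ac_simps)
    show ?thesis
      unfolding 1 2 3 sum.distrib[symmetric] distrib_left[symmetric] using eq_j by simp
  qed
  then show ?thesis using comb_adm by blast
qed

end

theorem theorem4p2: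
  fixes \<Omega> :: "(real^'d::finite) set"
    and T m M \<alpha> hs ht :: real
    and a :: "real \<Rightarrow> real"
    and Zs :: "'d \<Rightarrow> real list" and qs :: nat
    and Zt :: "real list" and qt :: nat
    and F :: "real^'d \<Rightarrow> real^'d"
    and f :: "(real^'d) \<times> real \<Rightarrow> real"
  assumes dom: "bounded \<Omega>" "lipschitz_domain \<Omega>"
    and T_pos: "T > 0"
    and a_lip: "\<exists>L. lipschitz_on L UNIV a"
    and mM: "0 < m" "m \<le> M" "\<And>s. m \<le> a s \<and> a s \<le> M"
    and degs: "qs \<ge> 1" "qt \<ge> 1"
    and knots: "\<And>k. open_knots_maxreg qs (Zs k)" "open_knots_maxreg qt Zt"
    and quasi: "0 < \<alpha>" "\<alpha> < 1" "\<And>k. quasi_uniform \<alpha> hs (Zs k)" "quasi_uniform \<alpha> ht Zt"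
    and F_bij: "bij_betw F unit_cube \<Omega>"
    and F_spline: "\<And>i. \<exists>s\<in>spatial_splines Zs qs. \<forall>\<zeta>\<in>unit_cube. F \<zeta> $ i = s \<zeta>"
    and F_inv: "\<And>e i. (\<forall>k. e k + 1 < length (Zs k)) \<Longrightarrow>
       bounded_derivs_all_orders (F ` mesh_element Zs e) (\<lambda>x. the_inv_into unit_cube F x $ i)"
    and f_L2: "set_borel_measurable lborel (\<Omega> \<times> {0<..<T}) f"
       "set_integrable lborel (\<Omega> \<times> {0<..<T}) (\<lambda>z. (f z)\<^sup>2)"
  shows "\<exists>uh\<in>Vh Zs qs Zt qt F T. \<forall>vh\<in>Vh Zs qs Zt qt F T.
     set_lebesgue_integral lborel (\<Omega> \<times> {0<..<T}) (\<lambda>z. time_deriv uh z * vh z)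
   + set_lebesgue_integral lborel (\<Omega> \<times> {0<..<T})
       (\<lambda>z. a (lmean \<Omega> uh (snd z)) * (space_grad uh z \<bullet> space_grad vh z))
   = set_lebesgue_integral lborel (\<Omega> \<times> {0<..<T}) (\<lambda>z. f z * vh z)"
proof -
  interpret iga_space \<Omega> T Zs qs Zt qt F
    using dom T_pos degs knots F_bij F_spline F_inv
    by unfold_locales (auto simp: lipschitz_domain_def)
  have "continuous_on UNIV a"
    using a_lip lipschitz_on_continuous_on by blast
  from galerkin_solution[OF this mM(1), of M f] mM(3) f_L2
  show ?thesis
    unfolding Vh_eq integral_N W_def by blast
qed

end
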